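(* For every constant $s\ge 1$, the Connected Vertex Cover problem can be solved in polynomial time on $sP_2$-free graphs.
   Context: All graphs are finite and simple. $P_2$ denotes the path on two vertices (an edge) and $sP_2$ the disjoint union of $s$ copies of $P_2$. A graph $G$ is $sP_2$-free if it has no induced subgraph isomorphic to $sP_2$. A vertex cover of $G$ is a set $S\subseteq V(G)$ such that every edge of $G$ has an end-vertex in $S$; it is connected if the induced subgraph $G[S]$ is connected. The Connected Vertex Cover problem: given a graph $G$ and an integer $k$, decide whether $G$ has a connected vertex cover $S$ with $|S|\le k$. *)

theory Defs
  imports
    "HOL-Computational_Algebra.Polynomial"
    "Graph_Theory.Digraph_Isomorphism"
begin

section \<open>Simple graphs\<close>

text \<open>
  A finite simple graph is a \<^locale>\<open>pair_graph\<close>: a finite loop-free symmetric digraph without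
  parallel arcs, an edge being represented by its two opposite arcs.
\<close>

definition P2 :: "bool pair_pre_digraph" where
  "P2 = \<lparr> pverts = {False, True}, parcs = {(False, True), (True, False)} \<rparr>"

definition copies :: "nat \<Rightarrow> 'a pair_pre_digraph \<Rightarrow> (nat \<times> 'a) pair_pre_digraph" where
  "copies s H = \<lparr> pverts = {..<s} \<times> pverts H,
                  parcs = {((i, u), (i, v)) | i u v. i < s \<and> (u, v) \<in> parcs H} \<rparr>"

definition induced_free :: "'b pair_pre_digraph \<Rightarrow> 'a pair_pre_digraph \<Rightarrow> bool" where
  "induced_free H G \<longleftrightarrow>
     \<not> (\<exists>K. induced_subgraph K (with_proj G) \<and> digraph_iso K (with_proj H))"

definition vertex_cover :: "'a pair_pre_digraph \<Rightarrow> 'a set \<Rightarrow> bool" where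
  "vertex_cover G S \<longleftrightarrow> S \<subseteq> pverts G \<and> (\<forall>(u, v) \<in> parcs G. u \<in> S \<or> v \<in> S)"

text \<open>
  The qualified name separates graph connectedness from the topological constant of the same name.
  The graph without vertices is not connected, so connected vertex covers are nonempty.
\<close>

definition connected_vertex_cover :: "'a pair_pre_digraph \<Rightarrow> 'a set \<Rightarrow> bool" where
  "connected_vertex_cover G S \<longleftrightarrow>
     vertex_cover G S \<and> Digraph_Component.connected (with_proj G \<restriction> S)"


section \<open>Polynomial time\<close>

text \<open>
  The machine model is the random access machine over the natural numbers, with addition and
  truncated subtraction as its only arithmetic and with unit cost. One step increases the bit length
  of the largest number stored by at most one (up to the constants in the program), so that
  polynomial time on this machine is polynomial time on Turing machines. Multiplication must not be
  added under unit cost. A program addresses its registers directly, and an unbounded memory,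
  separate from the registers, through them.
\<close>

datatype instr =
    Set nat nat      \<comment> \<open>\<open>Set r c\<close>: \<open>r := c\<close>\<close>
  | Add nat nat nat  \<comment> \<open>\<open>Add r a b\<close>: \<open>r := a + b\<close>\<close>
  | Sub nat nat nat  \<comment> \<open>\<open>Sub r a b\<close>: \<open>r := a - b\<close>\<close>
  | Load nat nat     \<comment> \<open>\<open>Load r a\<close>: \<open>r := mem[a]\<close>\<close>
  | Store nat nat    \<comment> \<open>\<open>Store a r\<close>: \<open>mem[a] := r\<close>\<close>
  | Jz nat nat       \<comment> \<open>\<open>Jz r l\<close>: go to instruction \<open>l\<close> if \<open>r = 0\<close>\<close>

type_synonym prog = "instr list"

record config =
  pc :: nat
  reg :: "nat \<Rightarrow> nat"
  mem :: "nat \<Rightarrow> nat"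

fun exec :: "instr \<Rightarrow> config \<Rightarrow> config" where
  "exec (Set r c) \<sigma> = \<sigma>\<lparr>pc := pc \<sigma> + 1, reg := (reg \<sigma>)(r := c)\<rparr>"
| "exec (Add r a b) \<sigma> = \<sigma>\<lparr>pc := pc \<sigma> + 1, reg := (reg \<sigma>)(r := reg \<sigma> a + reg \<sigma> b)\<rparr>"
| "exec (Sub r a b) \<sigma> = \<sigma>\<lparr>pc := pc \<sigma> + 1, reg := (reg \<sigma>)(r := reg \<sigma> a - reg \<sigma> b)\<rparr>"
| "exec (Load r a) \<sigma> = \<sigma>\<lparr>pc := pc \<sigma> + 1, reg := (reg \<sigma>)(r := mem \<sigma> (reg \<sigma> a))\<rparr>"
| "exec (Store a r) \<sigma> = \<sigma>\<lparr>pc := pc \<sigma> + 1, mem := (mem \<sigma>)(reg \<sigma> a := reg \<sigma> r)\<rparr>"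
| "exec (Jz r l) \<sigma> = \<sigma>\<lparr>pc := (if reg \<sigma> r = 0 then l else pc \<sigma> + 1)\<rparr>"

definition halted :: "prog \<Rightarrow> config \<Rightarrow> bool" where
  "halted P \<sigma> \<longleftrightarrow> pc \<sigma> \<ge> length P"

definition step :: "prog \<Rightarrow> config \<Rightarrow> config" where
  "step P \<sigma> = (if halted P \<sigma> then \<sigma> else exec (P ! pc \<sigma>) \<sigma>)"

text \<open>The input is a bit string, stored in memory from address 0 on; register 0 holds its length.\<close>

definition init :: "bool list \<Rightarrow> config" where
  "init x = \<lparr> pc = 0,
              reg = (\<lambda>r. if r = 0 then length x else 0),
              mem = (\<lambda>a. if a < length x then of_bool (x ! a) else 0) \<rparr>"

text \<open>
  \<open>solvable_in_poly_time I enc yes\<close>: one program decides \<open>yes\<close> on every instance in \<open>I\<close> (on other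
  inputs its behaviour is arbitrary), in a number of steps bounded by a polynomial in the length of
  the encoded instance. The answer is yes iff register 0 is nonzero when the program halts.
\<close>

definition solvable_in_poly_time :: "'i set \<Rightarrow> ('i \<Rightarrow> bool list) \<Rightarrow> ('i \<Rightarrow> bool) \<Rightarrow> bool" where
  "solvable_in_poly_time I enc yes \<longleftrightarrow>
     (\<exists>(P :: prog) (p :: nat poly). \<forall>i \<in> I. \<exists>t \<le> poly p (length (enc i)).
        let \<sigma> = (step P ^^ t) (init (enc i)) in
        halted P \<sigma> \<and> (reg \<sigma> 0 \<noteq> 0 \<longleftrightarrow> yes i))"


section \<open>Connected Vertex Cover\<close>

text \<open>
  The graph of an instance has vertex set \<open>{0, \<dots>, n - 1}\<close>. It is written as \<open>n\<close> in unary, closed by a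
  zero, followed by the \<open>n\<^sup>2\<close> bits of the adjacency matrix, row by row. The integer \<open>k\<close> follows in
  binary: its sign, then the digits of its absolute value, least significant digit first.
\<close>

fun nat_bits :: "nat \<Rightarrow> bool list" where
  "nat_bits n = (if n = 0 then [] else odd n # nat_bits (n div 2))"

declare nat_bits.simps [simp del]

definition int_bits :: "int \<Rightarrow> bool list" where
  "int_bits k = (k < 0) # nat_bits (nat \<bar>k\<bar>)"

definition graph_bits :: "nat pair_pre_digraph \<Rightarrow> bool list" where
  "graph_bits G = (let n = card (pverts G) in
     replicate n True @ [False] @ [(u, v) \<in> parcs G. u \<leftarrow> [0..<n], v \<leftarrow> [0..<n]])"

definition cvc_encoding :: "nat pair_pre_digraph \<times> int \<Rightarrow> bool list" where
  "cvc_encoding = (\<lambda>(G, k). graph_bits G @ int_bits k)"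

definition cvc_instances :: "(nat pair_pre_digraph \<times> int) set" where
  "cvc_instances = {(G, k). pair_graph G \<and> (\<exists>n. pverts G = {..<n})}"

definition cvc :: "nat pair_pre_digraph \<times> int \<Rightarrow> bool" where
  "cvc = (\<lambda>(G, k). \<exists>S. connected_vertex_cover G S \<and> int (card S) \<le> k)"

end

theory Submission
  imports Defs
begin

text \<open>
  Let \<open>S\<close> be a connected vertex cover and \<open>I\<close> a maximal independent set containing its complement.
  Some \<open>T \<subseteq> S \<inter> I\<close> makes the complement of \<open>I\<close> connected, and a minimal such \<open>T\<close> with more than one
  element yields an induced matching of size at least \<open>|T| / 2\<close>. In turn, \<open>I\<close> is determined by an
  induced matching, via a greedy construction. In an \<open>sP\<^sub>2\<close>-free graph both are thus described by at most
  \<open>4 s\<close> vertices, and it suffices to run through all \<open>4 s\<close>-tuples of vertices and to test whether the set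
  that a tuple describes is a connected vertex cover of size at most \<open>k\<close>.

  The algorithm is written in a language in which every loop runs exactly as often as the input is
  long, so that the running time of a program is bounded by a polynomial that can be read off its text.
\<close>

section \<open>A loop language for the random access machine\<close>

text \<open>The complement of \<open>I\<close> lies inside \<open>S\<close> and already covers every
  edge, so the vertices of \<open>T\<close> only buy connectivity. As they are bought inside
  \<open>S\<close>, the described cover is no larger than \<open>S\<close> and no optimisation
  remains. The number \<open>4 * s\<close> splits into \<open>2 * s\<close> ends of the fewer than
  \<open>s\<close> matching pairs behind \<open>I\<close>, and \<open>2 * s\<close> places for
  \<open>T\<close>. The obstacle in bounding \<open>T\<close> is that pairing each of its elements
  with a neighbour which it separates from a root need not give an induced matching. The conflicts
  form a forest, so two colours remove them; this is the origin of the halving. A tuple can be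
  decoded in polynomial time because membership of \<open>v\<close> in \<open>I\<close> is decided
  by the part of \<open>I\<close> below \<open>v\<close>. Tuples that describe a useless set do no
  harm: covering, connectivity and size are tested directly. So soundness is immediate, and the
  combinatorics serves completeness.\<close>

datatype exp =
    Num nat
  | Var nat
  | Plus exp exp
  | Minus exp exp
  | Fetch exp
  | Cond exp exp exp
  | Sum nat exp

primrec eval :: "nat \<Rightarrow> exp \<Rightarrow> (nat \<Rightarrow> nat) \<Rightarrow> (nat \<Rightarrow> nat) \<Rightarrow> nat" where
  "eval L (Num c) \<eta> m = c"
| "eval L (Var x) \<eta> m = \<eta> x"
| "eval L (Plus a b) \<eta> m = eval L a \<eta> m + eval L b \<eta> m"
| "eval L (Minus a b) \<eta> m = eval L a \<eta> m - eval L b \<eta> m"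
| "eval L (Fetch a) \<eta> m = m (eval L a \<eta> m)"
| "eval L (Cond a b c) \<eta> m = (if eval L a \<eta> m \<noteq> 0 then eval L b \<eta> m else eval L c \<eta> m)"
| "eval L (Sum x e) \<eta> m = (\<Sum>k<L. eval L e (\<eta>(x := k)) m)"

text \<open>Commands change only the memory, and variables are counters bound by \<open>Sum\<close>
  and \<open>For\<close>. An environment is therefore matched by registers that the compiled body
  never overwrites.\<close>

datatype com =
    Write exp exp
  | Seq com com
  | For nat com

primrec run :: "nat \<Rightarrow> com \<Rightarrow> (nat \<Rightarrow> nat) \<Rightarrow> (nat \<Rightarrow> nat) \<Rightarrow> nat \<Rightarrow> nat" where
  "run L (Write a e) \<eta> m = m(eval L a \<eta> m := eval L e \<eta> m)"
| "run L (Seq c c') \<eta> m = run L c' \<eta> (run L c \<eta> m)"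
| "run L (For x c) \<eta> m = fold (\<lambda>k. run L c (\<eta>(x := k))) [0..<L] m"

text \<open>Jump targets are absolute, hence the argument \<open>p\<close>;
  \<open>p + 7 + length B\<close> is the first address behind the loop. The counter \<open>r\<close>
  is compared with the input length in register 0. The only jump is \<open>Jz\<close>, so the
  backward jump first clears the scratch register \<open>r + 1\<close>.\<close>

definition loop :: "nat \<Rightarrow> nat \<Rightarrow> prog \<Rightarrow> prog" where
  "loop r p B = [Set r 0, Sub (r + 1) 0 r, Jz (r + 1) (p + 7 + length B)] @ B @
     [Set (r + 1) 1, Add r r (r + 1), Set (r + 1) 0, Jz (r + 1) (p + 1)]"

text \<open>
  The value of the expression ends up in register \<open>d\<close>; the registers below \<open>d\<close>, among them those that
  \<open>\<rho>\<close> assigns to the variables, are left alone. The code is placed at address \<open>p\<close>.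
\<close>

primrec comp_exp :: "exp \<Rightarrow> (nat \<Rightarrow> nat) \<Rightarrow> nat \<Rightarrow> nat \<Rightarrow> prog" where
  "comp_exp (Num c) \<rho> d p = [Set d c]"
| "comp_exp (Var x) \<rho> d p = [Set d 0, Add d d (\<rho> x)]"
| "comp_exp (Plus a b) \<rho> d p =
     (let A = comp_exp a \<rho> d p in A @ comp_exp b \<rho> (d + 1) (p + length A) @ [Add d d (d + 1)])"
| "comp_exp (Minus a b) \<rho> d p =
     (let A = comp_exp a \<rho> d p in A @ comp_exp b \<rho> (d + 1) (p + length A) @ [Sub d d (d + 1)])"
| "comp_exp (Fetch a) \<rho> d p = comp_exp a \<rho> d p @ [Load d d]"
| "comp_exp (Cond a b c) \<rho> d p =
     (let A = comp_exp a \<rho> d p;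
          B = comp_exp b \<rho> d (p + length A + 1);
          q = p + length A + length B + 3;
          C = comp_exp c \<rho> d q
      in A @ [Jz d q] @ B @ [Set (d + 1) 0, Jz (d + 1) (q + length C)] @ C)"
| "comp_exp (Sum x e) \<rho> d p =
     [Set d 0] @ loop (d + 1) (p + 1) (comp_exp e (\<rho>(x := d + 1)) (d + 2) (p + 4) @ [Add d d (d + 2)])"

primrec comp_com :: "com \<Rightarrow> (nat \<Rightarrow> nat) \<Rightarrow> nat \<Rightarrow> nat \<Rightarrow> prog" where
  "comp_com (Write a e) \<rho> d p =
     (let A = comp_exp a \<rho> d p in A @ comp_exp e \<rho> (d + 1) (p + length A) @ [Store d (d + 1)])"
| "comp_com (Seq c c') \<rho> d p =
     (let C = comp_com c \<rho> d p in C @ comp_com c' \<rho> d (p + length C))"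
| "comp_com (For x c) \<rho> d p = loop d p (comp_com c (\<rho>(x := d)) (d + 1) (p + 3))"

text \<open>\<open>[:0, 1:]\<close> is the indeterminate, evaluated at the input length. A round
  costs 6 instructions besides the body, two in the test and four at the end; 3 pays for the
  initialisation and the final test. A conditional is charged for both branches.\<close>

primrec cost_exp :: "exp \<Rightarrow> nat poly" where
  "cost_exp (Num c) = 1"
| "cost_exp (Var x) = 2"
| "cost_exp (Plus a b) = cost_exp a + cost_exp b + 1"
| "cost_exp (Minus a b) = cost_exp a + cost_exp b + 1"
| "cost_exp (Fetch a) = cost_exp a + 1"
| "cost_exp (Cond a b c) = cost_exp a + cost_exp b + cost_exp c + 3"
| "cost_exp (Sum x e) = 1 + ([:0, 1:] * (cost_exp e + 1 + 6) + 3)"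

primrec cost_com :: "com \<Rightarrow> nat poly" where
  "cost_com (Write a e) = cost_exp a + cost_exp e + 1"
| "cost_com (Seq c c') = cost_com c + cost_com c'"
| "cost_com (For x c) = [:0, 1:] * (cost_com c + 6) + 3"

section \<open>Bounded executions and correctness of the compiled code\<close>

definition reaches :: "prog \<Rightarrow> nat \<Rightarrow> config \<Rightarrow> config \<Rightarrow> bool" where
  "reaches P T \<sigma> \<sigma>' \<longleftrightarrow> (\<exists>t \<le> T. (step P ^^ t) \<sigma> = \<sigma>')"

lemma reaches_refl: "reaches P 0 \<sigma> \<sigma>"
  by (auto simp: reaches_def)

lemma reaches_trans:
  assumes "reaches P T \<sigma> \<sigma>'" "reaches P T' \<sigma>' \<sigma>''"
  shows "reaches P (T + T') \<sigma> \<sigma>''"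
proof -
  obtain t t' where "t \<le> T" "t' \<le> T'" "(step P ^^ t) \<sigma> = \<sigma>'" "(step P ^^ t') \<sigma>' = \<sigma>''"
    using assms by (auto simp: reaches_def)
  then have "(step P ^^ (t' + t)) \<sigma> = \<sigma>''" "t' + t \<le> T + T'"
    by (auto simp: funpow_add)
  then show ?thesis by (auto simp: reaches_def)
qed

lemma reaches_mono: "reaches P T \<sigma> \<sigma>' \<Longrightarrow> T \<le> T' \<Longrightarrow> reaches P T' \<sigma> \<sigma>'"
  by (auto simp: reaches_def intro: le_trans)

primrec code_at :: "prog \<Rightarrow> nat \<Rightarrow> prog \<Rightarrow> bool" where
  "code_at P p [] \<longleftrightarrow> True"
| "code_at P p (i # C) \<longleftrightarrow> p < length P \<and> P ! p = i \<and> code_at P (p + 1) C"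

lemma code_at_append [simp]:
  "code_at P p (C @ D) \<longleftrightarrow> code_at P p C \<and> code_at P (p + length C) D"
  by (induction C arbitrary: p) auto

lemma code_at_middle: "code_at (A @ C @ B) (length A) C"
proof (induction C arbitrary: A)
  case (Cons i C)
  then show ?case using Cons[of "A @ [i]"] by simp
qed simp

lemma reaches_exec:
  assumes "pc \<sigma> < length P" "P ! pc \<sigma> = i"
  shows "reaches P 1 \<sigma> (exec i \<sigma>)"
  using assms by (auto simp: reaches_def step_def halted_def intro!: exI[of _ 1])

text \<open>A proof rule with invariant \<open>I\<close>. By \<open>stable\<close> the invariant
  sees only registers below \<open>r\<close>, so the loop may use \<open>r\<close> and
  \<open>r + 1\<close> freely; \<open>zero\<close> keeps the length available to the test. The body
  starts at \<open>p + 3\<close>, behind the three instructions of the head.\<close>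

lemma reaches_loop:
  assumes code: "code_at P p (loop r p B)" and r: "r \<ge> 1"
    and start: "pc \<sigma> = p" "reg \<sigma> 0 = L"
    and inv: "I 0 (reg \<sigma>) (mem \<sigma>)"
    and stable: "\<And>k f g m. I k f m \<Longrightarrow> (\<And>i. i < r \<Longrightarrow> g i = f i) \<Longrightarrow> I k g m"
    and zero: "\<And>k f m. I k f m \<Longrightarrow> f 0 = L"
    and body: "\<And>k \<tau>. k < L \<Longrightarrow> I k (reg \<tau>) (mem \<tau>) \<Longrightarrow> reg \<tau> r = k \<Longrightarrow> pc \<tau> = p + 3 \<Longrightarrow>
      \<exists>\<tau>'. reaches P T \<tau> \<tau>' \<and> pc \<tau>' = p + 3 + length B \<and> reg \<tau>' r = k \<and> I (Suc k) (reg \<tau>') (mem \<tau>')"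
  shows "\<exists>\<sigma>'. reaches P (L * (T + 6) + 3) \<sigma> \<sigma>' \<and> pc \<sigma>' = p + length (loop r p B) \<and>
    I L (reg \<sigma>') (mem \<sigma>')"
proof -
  let ?q = "p + 3 + length B"
  have c: "p < length P" "P ! p = Set r 0" "p + 1 < length P" "P ! (p + 1) = Sub (r + 1) 0 r"
    "p + 2 < length P" "P ! (p + 2) = Jz (r + 1) (p + 7 + length B)"
    "?q < length P" "P ! ?q = Set (r + 1) 1"
    "?q + 1 < length P" "P ! (?q + 1) = Add r r (r + 1)"
    "?q + 2 < length P" "P ! (?q + 2) = Set (r + 1) 0"
    "?q + 3 < length P" "P ! (?q + 3) = Jz (r + 1) (p + 1)"
    using code by (auto simp: loop_def eval_nat_numeral)
  have step1: "reaches P 1 \<tau> (exec i \<tau>)" if "pc \<tau> = l" "l < length P" "P ! l = i" for \<tau> l i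
    using that reaches_exec by simp
  \<comment> \<open>The test is at \<open>p + 1\<close>; the 2 pays for the last test, which leaves
    the loop.\<close>
  have iter: "\<exists>\<sigma>'. reaches P ((L - k) * (T + 6) + 2) \<tau> \<sigma>' \<and> pc \<sigma>' = p + length (loop r p B) \<and>
      I L (reg \<sigma>') (mem \<sigma>')"
    if "k \<le> L" "I k (reg \<tau>) (mem \<tau>)" "reg \<tau> r = k" "pc \<tau> = p + 1" for k \<tau>
    using that
  proof (induction "L - k" arbitrary: k \<tau>)
    case 0
    then have k: "k = L" by simp
    let ?\<tau>1 = "exec (Sub (r + 1) 0 r) \<tau>"
    have r1: "reaches P 1 \<tau> ?\<tau>1" using step1 c 0(5) by blast
    have z: "reg ?\<tau>1 (r + 1) = 0" using 0 k zero[OF 0(3)] r by auto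
    have pc1: "pc ?\<tau>1 = p + 2" using 0 by simp
    have "reaches P 1 ?\<tau>1 (exec (Jz (r + 1) (p + 7 + length B)) ?\<tau>1)"
      using step1 c pc1 by blast
    from reaches_trans[OF r1 this]
    have "reaches P 2 \<tau> (exec (Jz (r + 1) (p + 7 + length B)) ?\<tau>1)"
      by (simp only: one_add_one)
    moreover have "pc (exec (Jz (r + 1) (p + 7 + length B)) ?\<tau>1) = p + length (loop r p B)"
      using z by (simp add: loop_def)
    moreover have "I L (reg (exec (Jz (r + 1) (p + 7 + length B)) ?\<tau>1))
        (mem (exec (Jz (r + 1) (p + 7 + length B)) ?\<tau>1))"
      using stable[OF 0(3)] k by simp
    moreover have "(L - k) * (T + 6) + 2 = 2" using k by simp
    ultimately show ?case
      by (intro exI[of _ "exec (Jz (r + 1) (p + 7 + length B)) ?\<tau>1"]) (simp only:)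
  next
    case (Suc j)
    then have k: "k < L" and j: "j = L - Suc k" by simp_all
    let ?\<tau>1 = "exec (Sub (r + 1) 0 r) \<tau>"
    have r1: "reaches P 1 \<tau> ?\<tau>1" using step1 c Suc.prems by blast
    have z: "reg ?\<tau>1 (r + 1) \<noteq> 0" using Suc.prems k zero[OF Suc(4)] r by auto
    have pc1: "pc ?\<tau>1 = p + 2" using Suc.prems by simp
    let ?\<tau>2 = "exec (Jz (r + 1) (p + 7 + length B)) ?\<tau>1"
    have r2: "reaches P 1 ?\<tau>1 ?\<tau>2"
      using step1 c pc1 by blast
    have "I k (reg ?\<tau>2) (mem ?\<tau>2)" "reg ?\<tau>2 r = k" "pc ?\<tau>2 = p + 3"
      using stable[OF Suc(4)] z Suc.prems by auto
    from body[OF k this] obtain \<tau>3 where t3: "reaches P T ?\<tau>2 \<tau>3" "pc \<tau>3 = ?q" "reg \<tau>3 r = k"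
      "I (Suc k) (reg \<tau>3) (mem \<tau>3)" by blast
    let ?\<tau>4 = "exec (Set (r + 1) 1) \<tau>3"
    let ?\<tau>5 = "exec (Add r r (r + 1)) ?\<tau>4"
    let ?\<tau>6 = "exec (Set (r + 1) 0) ?\<tau>5"
    let ?\<tau>7 = "exec (Jz (r + 1) (p + 1)) ?\<tau>6"
    have r4: "reaches P 1 \<tau>3 ?\<tau>4" using step1 c t3(2) by blast
    have p4: "pc ?\<tau>4 = ?q + 1" using t3 by simp
    have r5: "reaches P 1 ?\<tau>4 ?\<tau>5" using step1 c p4 by blast
    have p5: "pc ?\<tau>5 = ?q + 2" using t3 by simp
    have r6: "reaches P 1 ?\<tau>5 ?\<tau>6" using step1 c p5 by blast
    have p6: "pc ?\<tau>6 = ?q + 3" using t3 by simp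
    have r7: "reaches P 1 ?\<tau>6 ?\<tau>7" using step1 c p6 by blast
    have "I (Suc k) (reg ?\<tau>7) (mem ?\<tau>7)" "reg ?\<tau>7 r = Suc k" "pc ?\<tau>7 = p + 1"
      using stable[OF t3(4)] t3 by auto
    from Suc.hyps(1)[OF j Suc_leI[OF k] this] obtain \<sigma>' where s': 
      "reaches P ((L - Suc k) * (T + 6) + 2) ?\<tau>7 \<sigma>'" "pc \<sigma>' = p + length (loop r p B)"
      "I L (reg \<sigma>') (mem \<sigma>')" by blast
    have "reaches P (1 + (1 + (T + (1 + (1 + (1 + (1 + ((L - Suc k) * (T + 6) + 2)))))))) \<tau> \<sigma>'"
      by (rule reaches_trans[OF r1] reaches_trans[OF r2] reaches_trans[OF t3(1)] reaches_trans[OF r4]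
          reaches_trans[OF r5] reaches_trans[OF r6] reaches_trans[OF r7] s')+
    moreover have "1 + (1 + (T + (1 + (1 + (1 + (1 + ((L - Suc k) * (T + 6) + 2))))))) =
        (L - k) * (T + 6) + 2"
    proof -
      have "L - k = Suc (L - Suc k)" using k by simp
      then have "(L - k) * (T + 6) = T + 6 + (L - Suc k) * (T + 6)" by (simp only: mult_Suc)
      then show ?thesis by simp
    qed
    ultimately show ?case using s' by (metis (no_types))
  qed
  let ?\<sigma>1 = "exec (Set r 0) \<sigma>"
  have r1: "reaches P 1 \<sigma> ?\<sigma>1" using step1 c start by blast
  have "I 0 (reg ?\<sigma>1) (mem ?\<sigma>1)" "reg ?\<sigma>1 r = 0" "pc ?\<sigma>1 = p + 1"
    using stable[OF inv] start by auto
  from iter[OF _ this] obtain \<sigma>' where "reaches P ((L - 0) * (T + 6) + 2) ?\<sigma>1 \<sigma>'"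
     "pc \<sigma>' = p + length (loop r p B)" "I L (reg \<sigma>') (mem \<sigma>')" by auto
  moreover from reaches_trans[OF r1 this(1)] have "reaches P (L * (T + 6) + 3) \<sigma> \<sigma>'"
    by (simp add: numeral_3_eq_3)
  ultimately show ?thesis by blast
qed

lemma reaches_then_exec:
  assumes "reaches P T \<sigma> \<tau>" "pc \<tau> = p" "code_at P p (i # C)"
  shows "reaches P (T + 1) \<sigma> (exec i \<tau>)"
  using reaches_trans[OF assms(1) reaches_exec] assms by auto

text \<open>The induction goes through because a second operand is compiled with
  \<open>d + 1\<close>, which protects the first value in \<open>d\<close>. The bound
  \<open>d \<ge> 1\<close> protects the input length in register 0.\<close>

lemma comp_exp_correct:
  assumes "code_at P p (comp_exp e \<rho> d p)" "pc \<sigma> = p" "d \<ge> 1" "reg \<sigma> 0 = L"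
    and "\<And>x. \<rho> x < d" "\<And>x. reg \<sigma> (\<rho> x) = \<eta> x"
  shows "\<exists>\<sigma>'. reaches P (poly (cost_exp e) L) \<sigma> \<sigma>' \<and> pc \<sigma>' = p + length (comp_exp e \<rho> d p) \<and>
    (\<forall>r<d. reg \<sigma>' r = reg \<sigma> r) \<and> reg \<sigma>' d = eval L e \<eta> (mem \<sigma>) \<and> mem \<sigma>' = mem \<sigma>"
  using assms
proof (induction e arbitrary: p \<rho> d \<sigma> \<eta>)
  case (Num c)
  show ?case
    using reaches_then_exec[OF reaches_refl, where C = "[]" and \<sigma> = \<sigma> and p = p and P = P] Num
    by (intro exI[of _ "exec (Set d c) \<sigma>"]) simp
next
  case (Var x)
  let ?\<tau> = "exec (Set d 0) \<sigma>"
  have c: "code_at P p [Set d 0, Add d d (\<rho> x)]" "code_at P (p + 1) [Add d d (\<rho> x)]"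
    using Var by auto
  have "reaches P (0 + 1) \<sigma> ?\<tau>"
    using reaches_then_exec[OF reaches_refl _ c(1)] Var by simp
  from reaches_then_exec[OF this _ c(2)] have "reaches P 2 \<sigma> (exec (Add d d (\<rho> x)) ?\<tau>)"
    using Var by (simp add: numeral_2_eq_2)
  moreover have "\<rho> x \<noteq> d" using Var(5)[of x] by simp
  ultimately show ?case using Var by (intro exI[of _ "exec (Add d d (\<rho> x)) ?\<tau>"]) simp
next
  case (Plus a b)
  let ?A = "comp_exp a \<rho> d p"
  let ?B = "comp_exp b \<rho> (d + 1) (p + length ?A)"
  have c: "code_at P p ?A" "code_at P (p + length ?A) ?B"
    "code_at P (p + length ?A + length ?B) [Add d d (d + 1)]"
    using Plus.prems(1) by (auto simp: Let_def add.assoc)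
  from Plus.IH(1)[OF c(1) Plus.prems(2-)] obtain \<tau> where t: "reaches P (poly (cost_exp a) L) \<sigma> \<tau>"
     "pc \<tau> = p + length ?A" "\<forall>r<d. reg \<tau> r = reg \<sigma> r" "reg \<tau> d = eval L a \<eta> (mem \<sigma>)"
     "mem \<tau> = mem \<sigma>" by blast
  have "\<rho> x < d + 1" "reg \<tau> (\<rho> x) = \<eta> x" for x
    using t(3) Plus.prems(5,6) by (auto intro: less_SucI)
  from Plus.IH(2)[OF c(2) t(2) _ _ this] obtain \<tau>' where t': "reaches P (poly (cost_exp b) L) \<tau> \<tau>'"
     "pc \<tau>' = p + length ?A + length ?B" "\<forall>r<d+1. reg \<tau>' r = reg \<tau> r"
     "reg \<tau>' (d + 1) = eval L b \<eta> (mem \<sigma>)" "mem \<tau>' = mem \<sigma>"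
    using t Plus.prems by auto
  from reaches_then_exec[OF reaches_trans[OF t(1) t'(1)] t'(2) c(3)]
  have "reaches P (poly (cost_exp (Plus a b)) L) \<sigma> (exec (Add d d (d + 1)) \<tau>')" by simp
  then show ?case
    using t t' by (intro exI[of _ "exec (Add d d (d + 1)) \<tau>'"]) (simp add: Let_def)
next
  case (Minus a b)
  let ?A = "comp_exp a \<rho> d p"
  let ?B = "comp_exp b \<rho> (d + 1) (p + length ?A)"
  have c: "code_at P p ?A" "code_at P (p + length ?A) ?B"
    "code_at P (p + length ?A + length ?B) [Sub d d (d + 1)]"
    using Minus.prems(1) by (auto simp: Let_def add.assoc)
  from Minus.IH(1)[OF c(1) Minus.prems(2-)] obtain \<tau> where t: "reaches P (poly (cost_exp a) L) \<sigma> \<tau>"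
     "pc \<tau> = p + length ?A" "\<forall>r<d. reg \<tau> r = reg \<sigma> r" "reg \<tau> d = eval L a \<eta> (mem \<sigma>)"
     "mem \<tau> = mem \<sigma>" by blast
  have "\<rho> x < d + 1" "reg \<tau> (\<rho> x) = \<eta> x" for x
    using t(3) Minus.prems(5,6) by (auto intro: less_SucI)
  from Minus.IH(2)[OF c(2) t(2) _ _ this] obtain \<tau>' where t': "reaches P (poly (cost_exp b) L) \<tau> \<tau>'"
     "pc \<tau>' = p + length ?A + length ?B" "\<forall>r<d+1. reg \<tau>' r = reg \<tau> r"
     "reg \<tau>' (d + 1) = eval L b \<eta> (mem \<sigma>)" "mem \<tau>' = mem \<sigma>"
    using t Minus.prems by auto
  from reaches_then_exec[OF reaches_trans[OF t(1) t'(1)] t'(2) c(3)]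
  have "reaches P (poly (cost_exp (Minus a b)) L) \<sigma> (exec (Sub d d (d + 1)) \<tau>')" by simp
  then show ?case
    using t t' by (intro exI[of _ "exec (Sub d d (d + 1)) \<tau>'"]) (simp add: Let_def)
next
  case (Fetch a)
  let ?A = "comp_exp a \<rho> d p"
  have c: "code_at P p ?A" "code_at P (p + length ?A) [Load d d]"
    using Fetch.prems(1) by auto
  from Fetch.IH[OF c(1) Fetch.prems(2-)] obtain \<tau> where t: "reaches P (poly (cost_exp a) L) \<sigma> \<tau>"
     "pc \<tau> = p + length ?A" "\<forall>r<d. reg \<tau> r = reg \<sigma> r" "reg \<tau> d = eval L a \<eta> (mem \<sigma>)"
     "mem \<tau> = mem \<sigma>" by blast
  show ?case
    using t reaches_then_exec[OF t(1,2) c(2)] by (intro exI[of _ "exec (Load d d) \<tau>"]) simp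
next
  case (Cond a b c)
  let ?A = "comp_exp a \<rho> d p"
  let ?B = "comp_exp b \<rho> d (p + length ?A + 1)"
  let ?q = "p + length ?A + length ?B + 3"
  let ?C = "comp_exp c \<rho> d ?q"
  have c: "code_at P p ?A" "code_at P (p + length ?A) [Jz d ?q]"
    "code_at P (p + length ?A + 1) ?B"
    "code_at P (p + length ?A + 1 + length ?B) [Set (d + 1) 0, Jz (d + 1) (?q + length ?C)]"
    "code_at P (p + length ?A + 1 + length ?B + 1) [Jz (d + 1) (?q + length ?C)]"
    "code_at P ?q ?C"
    using Cond.prems(1) by (auto simp: Let_def add_ac eval_nat_numeral)
  from Cond.IH(1)[OF c(1) Cond.prems(2-)] obtain \<tau> where t: "reaches P (poly (cost_exp a) L) \<sigma> \<tau>"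
     "pc \<tau> = p + length ?A" "\<forall>r<d. reg \<tau> r = reg \<sigma> r" "reg \<tau> d = eval L a \<eta> (mem \<sigma>)"
     "mem \<tau> = mem \<sigma>" by blast
  have len: "length (comp_exp (Cond a b c) \<rho> d p) = length ?A + length ?B + 3 + length ?C"
    by (simp add: Let_def)
  let ?\<tau>1 = "exec (Jz d ?q) \<tau>"
  have r1: "reaches P (poly (cost_exp a) L + 1) \<sigma> ?\<tau>1"
    using reaches_then_exec[OF t(1,2) c(2)] .
  have rho: "reg ?\<tau>1 (\<rho> x) = \<eta> x" for x
    using t(3) Cond.prems(5,6) by auto
  show ?case
  proof (cases "eval L a \<eta> (mem \<sigma>) = 0")
    case True
    then have "pc ?\<tau>1 = ?q" using t by simp
    from Cond.IH(3)[OF c(6) this _ _ Cond.prems(5) rho] obtain \<tau>' where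
      t': "reaches P (poly (cost_exp c) L) ?\<tau>1 \<tau>'"
      "pc \<tau>' = ?q + length ?C" "\<forall>r<d. reg \<tau>' r = reg \<tau> r"
      "reg \<tau>' d = eval L c \<eta> (mem \<sigma>)" "mem \<tau>' = mem \<sigma>"
      using t Cond.prems by auto
    have "reaches P (poly (cost_exp (Cond a b c)) L) \<sigma> \<tau>'"
      by (rule reaches_mono[OF reaches_trans[OF r1 t'(1)]]) simp
    then show ?thesis
      using t t' len True by (intro exI[of _ \<tau>']) simp
  next
    case False
    then have "pc ?\<tau>1 = p + length ?A + 1" using t by simp
    from Cond.IH(2)[OF c(3) this _ _ Cond.prems(5) rho] obtain \<tau>' where
      t': "reaches P (poly (cost_exp b) L) ?\<tau>1 \<tau>'"
      "pc \<tau>' = p + length ?A + 1 + length ?B" "\<forall>r<d. reg \<tau>' r = reg \<tau> r"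
      "reg \<tau>' d = eval L b \<eta> (mem \<sigma>)" "mem \<tau>' = mem \<sigma>"
      using t Cond.prems by auto
    let ?\<tau>2 = "exec (Set (d + 1) 0) \<tau>'"
    let ?\<tau>3 = "exec (Jz (d + 1) (?q + length ?C)) ?\<tau>2"
    note r2 = reaches_then_exec[OF reaches_trans[OF r1 t'(1)] t'(2) c(4)]
    have "reaches P (poly (cost_exp a) L + 1 + poly (cost_exp b) L + 1 + 1) \<sigma> ?\<tau>3"
      by (rule reaches_then_exec[OF r2 _ c(5)]) (use t' in simp)
    then have "reaches P (poly (cost_exp (Cond a b c)) L) \<sigma> ?\<tau>3"
      by (rule reaches_mono) simp
    then show ?thesis
      using t t' len False by (intro exI[of _ ?\<tau>3]) simp
  qed
next
  case (Sum x e)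
  let ?E = "comp_exp e (\<rho>(x := d + 1)) (d + 2) (p + 4)"
  let ?B = "?E @ [Add d d (d + 2)]"
  have c: "code_at P p [Set d 0]" "code_at P (p + 1) (loop (d + 1) (p + 1) ?B)"
    using Sum.prems(1) by auto
  have ce: "code_at P (p + 4) ?E" "code_at P (p + 4 + length ?E) [Add d d (d + 2)]"
    using c(2) by (auto simp: loop_def eval_nat_numeral)
  let ?\<sigma>1 = "exec (Set d 0) \<sigma>"
  have r1: "reaches P 1 \<sigma> ?\<sigma>1"
    using reaches_then_exec[OF reaches_refl Sum.prems(2) c(1)] by simp
  let ?S = "\<lambda>k. \<Sum>i<k. eval L e (\<eta>(x := i)) (mem \<sigma>)"
  have "\<exists>\<sigma>'. reaches P (L * (poly (cost_exp e) L + 1 + 6) + 3) ?\<sigma>1 \<sigma>' \<and>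
      pc \<sigma>' = p + 1 + length (loop (d + 1) (p + 1) ?B) \<and>
      (\<forall>r<d. reg \<sigma>' r = reg \<sigma> r) \<and> reg \<sigma>' d = ?S L \<and> mem \<sigma>' = mem \<sigma>"
  \<comment> \<open>Register \<open>d\<close> accumulates the partial sum, \<open>d + 1\<close> is
    both the counter and the variable \<open>x\<close>, and the summand is computed in
    \<open>d + 2\<close>.\<close>
  proof (rule reaches_loop[where I = "\<lambda>k f m. (\<forall>r<d. f r = reg \<sigma> r) \<and> f d = ?S k \<and> m = mem \<sigma>",
        OF c(2)])
    fix k and \<tau> :: config
    assume k: "k < L" and I: "(\<forall>r<d. reg \<tau> r = reg \<sigma> r) \<and> reg \<tau> d = ?S k \<and> mem \<tau> = mem \<sigma>"
      and "reg \<tau> (d + 1) = k" and pc: "pc \<tau> = p + 1 + 3"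
    then have rho: "(\<rho>(x := d + 1)) y < d + 2" "reg \<tau> ((\<rho>(x := d + 1)) y) = (\<eta>(x := k)) y" for y
      using Sum.prems(5,6)[of y] by auto
    have pre: "pc \<tau> = p + 4" "1 \<le> d + 2" "reg \<tau> 0 = L" and m: "mem \<tau> = mem \<sigma>"
      using pc I Sum.prems by auto
    from Sum.IH[where \<rho> = "\<rho>(x := d + 1)" and \<eta> = "\<eta>(x := k)", OF ce(1) pre rho, unfolded m] obtain \<tau>' where
      t': "reaches P (poly (cost_exp e) L) \<tau> \<tau>'" "pc \<tau>' = p + 4 + length ?E"
      "\<forall>r<d+2. reg \<tau>' r = reg \<tau> r" "reg \<tau>' (d + 2) = eval L e (\<eta>(x := k)) (mem \<sigma>)"
      "mem \<tau>' = mem \<sigma>" by blast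
    have "reaches P (poly (cost_exp e) L + 1) \<tau> (exec (Add d d (d + 2)) \<tau>')"
      by (rule reaches_then_exec[OF t'(1,2) ce(2)])
    then show "\<exists>\<tau>'. reaches P (poly (cost_exp e) L + 1) \<tau> \<tau>' \<and> pc \<tau>' = p + 1 + 3 + length ?B \<and>
       reg \<tau>' (d + 1) = k \<and> (\<forall>r<d. reg \<tau>' r = reg \<sigma> r) \<and> reg \<tau>' d = ?S (Suc k) \<and> mem \<tau>' = mem \<sigma>"
      using t' I \<open>reg \<tau> (d + 1) = k\<close>
      by (intro exI[of _ "exec (Add d d (d + 2)) \<tau>'"]) (simp add: lessThan_Suc)
  qed (use Sum.prems in auto)
  then obtain \<sigma>' where s': "reaches P (L * (poly (cost_exp e) L + 1 + 6) + 3) ?\<sigma>1 \<sigma>'"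
      "pc \<sigma>' = p + 1 + length (loop (d + 1) (p + 1) ?B)"
      "(\<forall>r<d. reg \<sigma>' r = reg \<sigma> r)" "reg \<sigma>' d = ?S L" "mem \<sigma>' = mem \<sigma>" by blast
  have "reaches P (poly (cost_exp (Sum x e)) L) \<sigma> \<sigma>'"
    using reaches_trans[OF r1 s'(1)] by (simp add: algebra_simps)
  then show ?case using s' by (intro exI[of _ \<sigma>']) simp
qed

lemma comp_com_correct:
  assumes "code_at P p (comp_com c \<rho> d p)" "pc \<sigma> = p" "d \<ge> 1" "reg \<sigma> 0 = L"
    and "\<And>x. \<rho> x < d" "\<And>x. reg \<sigma> (\<rho> x) = \<eta> x"
  shows "\<exists>\<sigma>'. reaches P (poly (cost_com c) L) \<sigma> \<sigma>' \<and> pc \<sigma>' = p + length (comp_com c \<rho> d p) \<and>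
    (\<forall>r<d. reg \<sigma>' r = reg \<sigma> r) \<and> mem \<sigma>' = run L c \<eta> (mem \<sigma>)"
  using assms
proof (induction c arbitrary: p \<rho> d \<sigma> \<eta>)
  case (Write a b)
  let ?A = "comp_exp a \<rho> d p"
  let ?B = "comp_exp b \<rho> (d + 1) (p + length ?A)"
  have c: "code_at P p ?A" "code_at P (p + length ?A) ?B"
    "code_at P (p + length ?A + length ?B) [Store d (d + 1)]"
    using Write.prems(1) by (auto simp: Let_def add.assoc)
  from comp_exp_correct[OF c(1) Write.prems(2-)] obtain \<tau> where
    t: "reaches P (poly (cost_exp a) L) \<sigma> \<tau>"
     "pc \<tau> = p + length ?A" "\<forall>r<d. reg \<tau> r = reg \<sigma> r" "reg \<tau> d = eval L a \<eta> (mem \<sigma>)"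
     "mem \<tau> = mem \<sigma>" by blast
  have "\<rho> x < d + 1" "reg \<tau> (\<rho> x) = \<eta> x" for x
    using t(3) Write.prems(5,6) by (auto intro: less_SucI)
  from comp_exp_correct[OF c(2) t(2) _ _ this] obtain \<tau>' where
    t': "reaches P (poly (cost_exp b) L) \<tau> \<tau>'"
     "pc \<tau>' = p + length ?A + length ?B" "\<forall>r<d+1. reg \<tau>' r = reg \<tau> r"
     "reg \<tau>' (d + 1) = eval L b \<eta> (mem \<sigma>)" "mem \<tau>' = mem \<sigma>"
    using t Write.prems by auto
  from reaches_then_exec[OF reaches_trans[OF t(1) t'(1)] t'(2) c(3)]
  have "reaches P (poly (cost_com (Write a b)) L) \<sigma> (exec (Store d (d + 1)) \<tau>')" by simp
  then show ?case
    using t t' by (intro exI[of _ "exec (Store d (d + 1)) \<tau>'"]) (simp add: Let_def)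
next
  case (Seq c1 c2)
  let ?A = "comp_com c1 \<rho> d p"
  let ?B = "comp_com c2 \<rho> d (p + length ?A)"
  have c: "code_at P p ?A" "code_at P (p + length ?A) ?B"
    using Seq.prems(1) by (auto simp: Let_def add.assoc)
  from Seq.IH(1)[OF c(1) Seq.prems(2-)] obtain \<tau> where t: "reaches P (poly (cost_com c1) L) \<sigma> \<tau>"
     "pc \<tau> = p + length ?A" "\<forall>r<d. reg \<tau> r = reg \<sigma> r" "mem \<tau> = run L c1 \<eta> (mem \<sigma>)" by blast
  have "reg \<tau> (\<rho> x) = \<eta> x" for x
    using t(3) Seq.prems(5,6) by auto
  from Seq.IH(2)[OF c(2) t(2) _ _ Seq.prems(5) this] obtain \<tau>' where
    t': "reaches P (poly (cost_com c2) L) \<tau> \<tau>'"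
     "pc \<tau>' = p + length ?A + length ?B" "\<forall>r<d. reg \<tau>' r = reg \<tau> r"
     "mem \<tau>' = run L c2 \<eta> (mem \<tau>)"
    using t Seq.prems by auto
  have "reaches P (poly (cost_com (Seq c1 c2)) L) \<sigma> \<tau>'"
    using reaches_trans[OF t(1) t'(1)] by simp
  then show ?case using t t' by (intro exI[of _ \<tau>']) (simp add: Let_def)
next
  case (For x c)
  let ?B = "comp_com c (\<rho>(x := d)) (d + 1) (p + 3)"
  have c: "code_at P p (loop d p ?B)"
    using For.prems(1) by auto
  have ce: "code_at P (p + 3) ?B"
    using c by (auto simp: loop_def eval_nat_numeral)
  let ?S = "\<lambda>k. fold (\<lambda>k. run L c (\<eta>(x := k))) [0..<k] (mem \<sigma>)"
  have "\<exists>\<sigma>'. reaches P (L * (poly (cost_com c) L + 6) + 3) \<sigma> \<sigma>' \<and>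
      pc \<sigma>' = p + length (loop d p ?B) \<and> (\<forall>r<d. reg \<sigma>' r = reg \<sigma> r) \<and> mem \<sigma>' = ?S L"
  proof (rule reaches_loop[where I = "\<lambda>k f m. (\<forall>r<d. f r = reg \<sigma> r) \<and> m = ?S k", OF c])
    fix k and \<tau> :: config
    assume k: "k < L" and I: "(\<forall>r<d. reg \<tau> r = reg \<sigma> r) \<and> mem \<tau> = ?S k"
      and d: "reg \<tau> d = k" and pc: "pc \<tau> = p + 3"
    then have rho: "(\<rho>(x := d)) y < d + 1" "reg \<tau> ((\<rho>(x := d)) y) = (\<eta>(x := k)) y" for y
      using For.prems(5,6)[of y] by auto
    have pre: "1 \<le> d + 1" "reg \<tau> 0 = L" using I For.prems by auto
    from For.IH[where \<rho> = "\<rho>(x := d)" and \<eta> = "\<eta>(x := k)", OF ce pc pre rho] obtain \<tau>' where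
      t': "reaches P (poly (cost_com c) L) \<tau> \<tau>'" "pc \<tau>' = p + 3 + length ?B"
      "\<forall>r<d+1. reg \<tau>' r = reg \<tau> r" "mem \<tau>' = run L c (\<eta>(x := k)) (mem \<tau>)" by blast
    then show "\<exists>\<tau>'. reaches P (poly (cost_com c) L) \<tau> \<tau>' \<and> pc \<tau>' = p + 3 + length ?B \<and>
       reg \<tau>' d = k \<and> (\<forall>r<d. reg \<tau>' r = reg \<sigma> r) \<and> mem \<tau>' = ?S (Suc k)"
      using I d by (intro exI[of _ \<tau>']) simp
  qed (use For.prems in auto)
  then show ?case by (simp add: algebra_simps)
qed

text \<open>At the start every variable is assigned register 0, which holds the input length; hence
  the constant environment, and register 1 as the first free one. Two final instructions move the
  result from register 1 to register 0.\<close>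

theorem solvable_in_poly_time_if_run:
  assumes "\<And>i. i \<in> I \<Longrightarrow>
    (let L = length (enc i)
     in eval L e (\<lambda>_. L) (run L c (\<lambda>_. L) (mem (init (enc i)))) \<noteq> 0 \<longleftrightarrow> yes i)"
  shows "solvable_in_poly_time I enc yes"
proof -
  define C where "C = comp_com c (\<lambda>_. 0) 1 0"
  define E where "E = comp_exp e (\<lambda>_. 0) 1 (length C)"
  define P where "P = C @ E @ [Set 0 0, Add 0 0 1]"
  have code: "code_at P 0 C" "code_at P (length C) E"
    "code_at P (length C + length E) [Set 0 0, Add 0 0 1]"
    "code_at P (length C + length E + 1) [Add 0 0 1]"
    using code_at_middle[of "[]" P "[]"] by (auto simp: P_def)
  have "\<exists>t \<le> poly (cost_com c + cost_exp e + 2) (length (enc i)).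
        let \<sigma> = (step P ^^ t) (init (enc i)) in halted P \<sigma> \<and> (reg \<sigma> 0 \<noteq> 0 \<longleftrightarrow> yes i)"
    if i: "i \<in> I" for i
  proof -
    define L where "L = length (enc i)"
    define \<sigma> where "\<sigma> = init (enc i)"
    have s: "pc \<sigma> = 0" "reg \<sigma> 0 = L" by (auto simp: \<sigma>_def L_def init_def)
    obtain \<tau> where t: "reaches P (poly (cost_com c) L) \<sigma> \<tau>" "pc \<tau> = length C"
      "reg \<tau> 0 = L" "mem \<tau> = run L c (\<lambda>_. L) (mem \<sigma>)"
      using comp_com_correct[OF code(1)[unfolded C_def] s(1) _ s(2), of "\<lambda>_. L"] s
      by (auto simp: C_def)
    obtain \<tau>' where t': "reaches P (poly (cost_exp e) L) \<tau> \<tau>'" "pc \<tau>' = length C + length E"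
      "reg \<tau>' 1 = eval L e (\<lambda>_. L) (mem \<tau>)"
      using comp_exp_correct[OF code(2)[unfolded E_def] t(2) _ t(3), of "\<lambda>_. L"] t
      by (auto simp: E_def)
    note r2 = reaches_then_exec[OF reaches_trans[OF t(1) t'(1)] t'(2) code(3)]
    have "reaches P (poly (cost_com c) L + poly (cost_exp e) L + 1 + 1) \<sigma>
        (exec (Add 0 0 1) (exec (Set 0 0) \<tau>'))" (is "reaches P ?T \<sigma> ?\<sigma>'")
      by (rule reaches_then_exec[OF r2 _ code(4)]) (use t' in simp)
    then obtain t where "t \<le> ?T" "(step P ^^ t) \<sigma> = ?\<sigma>'" by (auto simp: reaches_def)
    moreover have "halted P ?\<sigma>'" "reg ?\<sigma>' 0 = eval L e (\<lambda>_. L) (run L c (\<lambda>_. L) (mem \<sigma>))"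
      using t t' by (auto simp: halted_def P_def)
    ultimately show ?thesis
      using assms[OF i] by (intro exI[of _ t]) (auto simp: L_def \<sigma>_def Let_def)
  qed
  then show ?thesis unfolding solvable_in_poly_time_def by blast
qed

section \<open>Maximal independent sets and connecting sets\<close>

definition independent :: "('a \<Rightarrow> 'a \<Rightarrow> bool) \<Rightarrow> 'a set \<Rightarrow> bool" where
  "independent E I \<longleftrightarrow> (\<forall>u\<in>I. \<forall>v\<in>I. \<not> E u v)"

definition maximal_independent :: "('a \<Rightarrow> 'a \<Rightarrow> bool) \<Rightarrow> 'a set \<Rightarrow> 'a set \<Rightarrow> bool" where
  "maximal_independent E A I \<longleftrightarrow> I \<subseteq> A \<and> independent E I \<and> (\<forall>v\<in>A - I. \<exists>u\<in>I. E v u)"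

text \<open>Edges are ordered pairs because their ends play different roles below: the second end
  lies in the independent set at hand, the first one outside.\<close>

definition induced_matching :: "('a \<Rightarrow> 'a \<Rightarrow> bool) \<Rightarrow> ('a \<times> 'a) set \<Rightarrow> bool" where
  "induced_matching E M \<longleftrightarrow> (\<forall>(a, b)\<in>M. E a b) \<and>
     (\<forall>p\<in>M. \<forall>q\<in>M. p \<noteq> q \<longrightarrow> (\<forall>x\<in>{fst p, snd p}. \<forall>y\<in>{fst q, snd q}. x \<noteq> y \<and> \<not> E x y))"

definition induced_arcs :: "('a \<Rightarrow> 'a \<Rightarrow> bool) \<Rightarrow> 'a set \<Rightarrow> 'a rel" where
  "induced_arcs E X = {(u, v). u \<in> X \<and> v \<in> X \<and> E u v}"

definition connected_on :: "('a \<Rightarrow> 'a \<Rightarrow> bool) \<Rightarrow> 'a set \<Rightarrow> bool" where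
  "connected_on E X \<longleftrightarrow> X \<noteq> {} \<and> (\<forall>u\<in>X. \<forall>v\<in>X. (u, v) \<in> (induced_arcs E X)\<^sup>*)"

section \<open>Maximal independent sets determined by induced matchings\<close>

lemma maximal_independent_extension:
  assumes "finite A" "I \<subseteq> A" "independent E I" "symp E"
    and irrefl: "\<And>u. \<not> E u u"
  obtains J where "I \<subseteq> J" "maximal_independent E A J"
proof -
  let ?F = "{J. J \<subseteq> A \<and> independent E J \<and> I \<subseteq> J}"
  have "finite ?F" "I \<in> ?F" using assms by auto
  then obtain J where J: "J \<in> ?F" "I \<subseteq> J" "\<And>K. K \<in> ?F \<Longrightarrow> J \<subseteq> K \<Longrightarrow> J = K"
    using finite_has_maximal2[of ?F I] by auto
  have "\<exists>u\<in>J. E v u" if v: "v \<in> A - J" for v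
  proof (rule ccontr)
    assume "\<not> ?thesis"
    then have "insert v J \<in> ?F"
      using J(1,2) v irrefl sympD[OF \<open>symp E\<close>] by (auto simp: independent_def)
    then show False using J(3)[of "insert v J"] v by auto
  qed
  then show thesis using that[of J] J by (auto simp: maximal_independent_def)
qed

text \<open>
  Call \<open>j \<in> I\<close> an exception if the part of \<open>I\<close> below \<open>j\<close> is not maximal among the elements below
  \<open>j\<close>, as witnessed by \<open>w\<close>. Above the largest exception, \<open>I\<close> is the greedy extension of its part
  below; below it, \<open>I\<close> is a maximal independent set of what remains after deleting the closed
  neighbourhoods of \<open>w\<close> and \<open>j\<close>, so that the exceptions collected recursively form an induced matching.
\<close>

lemma maximal_independent_greedy:
  fixes A :: "'a :: linorder set"
  assumes "finite A" "maximal_independent E A I" "symp E"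
  shows "\<exists>M. M \<subseteq> A \<times> A \<and> induced_matching E M \<and> snd ` M \<subseteq> I \<and>
    (\<forall>v\<in>A. v \<in> I \<longleftrightarrow> v \<in> snd ` M \<or> ((\<forall>u\<in>I. u < v \<longrightarrow> \<not> E v u) \<and>
      (\<forall>(w, j)\<in>M. v < j \<longrightarrow> v \<noteq> w \<and> \<not> E v w \<and> \<not> E v j)))"
  using assms(1,2)
proof (induction "card A" arbitrary: A I rule: less_induct)
  case less
  note sym = sympD[OF \<open>symp E\<close>]
  have I: "I \<subseteq> A" "\<And>u v. u \<in> I \<Longrightarrow> v \<in> I \<Longrightarrow> \<not> E u v" "\<And>v. v \<in> A \<Longrightarrow> v \<notin> I \<Longrightarrow> \<exists>u\<in>I. E v u"
    using less.prems(2) by (auto simp: maximal_independent_def independent_def)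
  have finI: "finite I" using I(1) less.prems(1) by (rule finite_subset)
  define X where "X = {j\<in>I. \<exists>w\<in>A. w \<notin> I \<and> w < j \<and> (\<forall>u\<in>I. u < j \<longrightarrow> \<not> E w u)}"
  have least: "\<exists>u\<in>I. E v u \<and> (\<forall>u'\<in>I. u' < u \<longrightarrow> \<not> E v u')" if "v \<in> A" "v \<notin> I" for v
  proof -
    let ?N = "{u\<in>I. E v u}"
    have "finite ?N" "?N \<noteq> {}" using finI I(3)[OF that] by auto
    then have "Min ?N \<in> ?N" "\<And>u. u \<in> ?N \<Longrightarrow> Min ?N \<le> u" using Min_in Min_le by blast+
    then show ?thesis by force
  qed
  \<comment> \<open>Applied to the least neighbour \<open>u\<close> in \<open>I\<close> of a vertex
    \<open>v\<close> outside \<open>I\<close>: either \<open>u < v\<close>, and the greedy rule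
    rejects \<open>v\<close>, or \<open>u\<close> is an exception witnessed by
    \<open>v\<close>.\<close>
  have exc: "u \<in> X" if "v \<in> A" "v \<notin> I" "u \<in> I" "\<forall>u'\<in>I. u' < u \<longrightarrow> \<not> E v u'" "v < u" for u v
    using that by (auto simp: X_def)
  show ?case
  proof (cases "X = {}")
    case True
    have "v \<in> I \<longleftrightarrow> (\<forall>u\<in>I. u < v \<longrightarrow> \<not> E v u)" if v: "v \<in> A" for v
    proof (cases "v \<in> I")
      case False
      from least[OF v this] obtain u where u: "u \<in> I" "E v u" "\<forall>u'\<in>I. u' < u \<longrightarrow> \<not> E v u'" by blast
      then have "\<not> v < u" using exc[OF v False] True by auto
      then have "u < v" using u False by (metis linorder_neqE)
      then show ?thesis using u False by blast
    qed (use I in auto)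
    then show ?thesis by (intro exI[of _ "{}"]) (auto simp: induced_matching_def)
  next
    case False
    define j where "j = Max X"
    have finX: "finite X" using finI by (auto simp: X_def)
    have j: "j \<in> X" "\<And>u. u \<in> X \<Longrightarrow> u \<le> j" using Max_in[OF finX False] Max_ge[OF finX] by (auto simp: j_def)
    then obtain w where w: "w \<in> A" "w \<notin> I" "w < j" "\<forall>u\<in>I. u < j \<longrightarrow> \<not> E w u" and jI: "j \<in> I"
      by (auto simp: X_def)
    \<comment> \<open>The least neighbour of \<open>w\<close> in \<open>I\<close> is not below
      \<open>j\<close>, hence it is above \<open>w\<close> and an exception; as \<open>j\<close> is
      the largest exception, it equals \<open>j\<close>.\<close>
    have Ewj: "E w j"
    proof -
      from least[OF w(1,2)] obtain u where u: "u \<in> I" "E w u" "\<forall>u'\<in>I. u' < u \<longrightarrow> \<not> E w u'" by blast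
      then have "j \<le> u" using w(4) by (meson not_le)
      then have "u \<in> X" using exc[OF w(1,2) u(1,3)] w(3) by auto
      then show ?thesis using j \<open>j \<le> u\<close> u(2) by (metis antisym)
    qed
    define B where "B = {v\<in>A. v < j \<and> v \<noteq> w \<and> \<not> E v w \<and> \<not> E v j}"
    define J where "J = {v\<in>I. v < j}"
    have "B \<subseteq> A" "j \<notin> B" "j \<in> A" using jI I(1) by (auto simp: B_def)
    then have cardB: "card B < card A" and finB: "finite B" using less.prems(1)
      by (auto intro!: psubset_card_mono intro: finite_subset)
    have J: "maximal_independent E B J"
    proof -
      \<comment> \<open>Since \<open>w\<close> has no neighbour in \<open>I\<close> below
        \<open>j\<close>, deleting its neighbourhood removes nothing of \<open>J\<close>.\<close>
      have "J \<subseteq> B" using I w(2,4) jI sym by (auto simp: J_def B_def)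
      moreover have "\<exists>u\<in>J. E v u" if v: "v \<in> B - J" for v
      proof -
        have vI: "v \<in> A" "v \<notin> I" "v < j" "\<not> E v j" using v by (auto simp: B_def J_def)
        from least[OF vI(1,2)] obtain u where u: "u \<in> I" "E v u" "\<forall>u'\<in>I. u' < u \<longrightarrow> \<not> E v u'" by blast
        \<comment> \<open>Otherwise \<open>u\<close> would be an exception, hence \<open>j\<close>
          itself, whose neighbours are not in \<open>B\<close>.\<close>
        have "u < j"
        proof (rule ccontr)
          assume "\<not> u < j"
          then have "v < u" using vI(3) by auto
          then have "u \<le> j" using exc[OF vI(1,2) u(1,3)] j(2) by blast
          then have "u = j" using \<open>\<not> u < j\<close> by auto
          then show False using u(2) vI(4) by blast
        qed
        then show ?thesis using u by (auto simp: J_def)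
      qed
      ultimately show ?thesis using I(2) by (auto simp: maximal_independent_def independent_def J_def)
    qed
    from less.hyps[OF cardB finB J]
    obtain M where M: "M \<subseteq> B \<times> B" "induced_matching E M" "snd ` M \<subseteq> J"
      "\<forall>v\<in>B. v \<in> J \<longleftrightarrow> v \<in> snd ` M \<or> ((\<forall>u\<in>J. u < v \<longrightarrow> \<not> E v u) \<and>
      (\<forall>(w, j)\<in>M. v < j \<longrightarrow> v \<noteq> w \<and> \<not> E v w \<and> \<not> E v j))"
      by (elim exE conjE)
    have "J \<subseteq> B" using J by (auto simp: maximal_independent_def)
    let ?M = "insert (w, j) M"
    have m1: "?M \<subseteq> A \<times> A" using M(1) w jI I(1) by (auto simp: B_def)
    have m2: "induced_matching E ?M"
    proof -
      have B: "x \<noteq> w" "x \<noteq> j" "\<not> E x w" "\<not> E x j" "\<not> E w x" "\<not> E j x" if "x \<in> B" for x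
        using that sym by (auto simp: B_def)
      have BM: "fst q \<in> B" "snd q \<in> B" if "q \<in> M" for q using that M(1) by auto
      have "\<forall>x\<in>{fst p, snd p}. \<forall>y\<in>{fst q, snd q}. x \<noteq> y \<and> \<not> E x y"
        if "p \<in> ?M" "q \<in> ?M" "p \<noteq> q" for p q
      proof -
        consider "p = (w, j)" "q \<in> M" | "q = (w, j)" "p \<in> M" | "p \<in> M" "q \<in> M" using \<open>p \<in> ?M\<close> \<open>q \<in> ?M\<close> \<open>p \<noteq> q\<close> by auto
        then show ?thesis
        proof cases
          case 1
          then show ?thesis using B[of "fst q"] B[of "snd q"] BM[of q] by auto
        next
          case 2
          then show ?thesis using B[of "fst p"] B[of "snd p"] BM[of p] by auto
        next
          case 3
          from M(2) have "\<forall>p\<in>M. \<forall>q\<in>M. p \<noteq> q \<longrightarrow>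
              (\<forall>x\<in>{fst p, snd p}. \<forall>y\<in>{fst q, snd q}. x \<noteq> y \<and> \<not> E x y)"
            unfolding induced_matching_def by (rule conjunct2)
          from this[rule_format, OF 3 \<open>p \<noteq> q\<close>] show ?thesis by blast
        qed
      qed
      moreover have "\<forall>(a, b)\<in>?M. E a b" using M(2) Ewj by (auto simp: induced_matching_def)
      ultimately show ?thesis by (simp only: induced_matching_def) blast
    qed
    have MI: "snd ` ?M \<subseteq> I" using M(3) jI by (auto simp: J_def)
    have m4: "v \<in> I \<longleftrightarrow> v \<in> snd ` ?M \<or> ((\<forall>u\<in>I. u < v \<longrightarrow> \<not> E v u) \<and>
      (\<forall>(w, j)\<in>?M. v < j \<longrightarrow> v \<noteq> w \<and> \<not> E v w \<and> \<not> E v j))" (is "_ \<longleftrightarrow> ?R v") if v: "v \<in> A" for v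
    proof
      assume vI: "v \<in> I"
      have "v \<noteq> w' \<and> \<not> E v w' \<and> \<not> E v j'" if "v \<notin> snd ` ?M" "(w', j') \<in> ?M" "v < j'" for w' j'
      proof -
        have "j' \<le> j" using that M(3) by (auto simp: J_def)
        then have "v \<in> J" using vI that by (auto simp: J_def)
        then have vB: "v \<in> B" using \<open>J \<subseteq> B\<close> by auto
        show ?thesis
        proof (cases "(w', j') = (w, j)")
          case True
          then show ?thesis using vB by (auto simp: B_def)
        next
          case False
          then show ?thesis using bspec[OF M(4) vB] \<open>v \<in> J\<close> that by auto
        qed
      qed
      then have "\<forall>(w', j')\<in>?M. v < j' \<longrightarrow> v \<noteq> w' \<and> \<not> E v w' \<and> \<not> E v j'" if "v \<notin> snd ` ?M"
        using that by blast
      then show "?R v" using I(2)[OF vI] by blast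
    next
      assume R: "?R v"
      consider "v < j" | "v = j" | "v > j" by (metis linorder_neqE)
      then show "v \<in> I"
      proof cases
        case 1
        show ?thesis
        proof (cases "v \<in> snd ` ?M")
          case True
          then show ?thesis using \<open>snd ` ?M \<subseteq> I\<close> by auto
        next
          case False
          \<comment> \<open>The clause of \<open>?R v\<close> for the pair \<open>(w, j)\<close> is
            exactly what puts a \<open>v\<close> below \<open>j\<close> into \<open>B\<close>, where
            the formula for \<open>M\<close> applies.\<close>
          then have "v \<in> B" using R v 1 by (auto simp: B_def)
          then have "v \<in> J" using bspec[OF M(4), of v] R False by (auto simp: J_def)
          then show ?thesis by (simp add: J_def)
        qed
      next
        case 2
        then show ?thesis using jI by simp
      next
        case 3
        show ?thesis
        proof (rule ccontr)
          assume vI: "v \<notin> I"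
          from least[OF v this] obtain u where u: "u \<in> I" "E v u" "\<forall>u'\<in>I. u' < u \<longrightarrow> \<not> E v u'" by blast
          have "v \<notin> snd ` ?M" using vI \<open>snd ` ?M \<subseteq> I\<close> by blast
          then have "\<not> u < v" using R u by blast
          \<comment> \<open>Such a \<open>u\<close> would be an exception beyond the largest
            one.\<close>
          then have "v < u" using u vI by (metis linorder_neqE)
          then have "u \<le> j" using exc[OF v vI u(1,3)] j(2) by blast
          then show False using 3 \<open>v < u\<close> by auto
        qed
      qed
    qed
    show ?thesis by (rule exI[of _ ?M], intro conjI ballI, fact m1, fact m2, fact MI, rule m4)
  qed
qed

section \<open>Two-colouring of forests and small connecting sets\<close>

lemma indegree_one_two_colouring:
  fixes f :: "'a \<Rightarrow> nat"
  assumes "finite T"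
    and "\<And>a b. a \<in> T \<Longrightarrow> b \<in> T \<Longrightarrow> P a b \<Longrightarrow> f b < f a"
    and "\<And>a b c. a \<in> T \<Longrightarrow> b \<in> T \<Longrightarrow> c \<in> T \<Longrightarrow> P a c \<Longrightarrow> P b c \<Longrightarrow> a = b"
  shows "\<exists>col :: 'a \<Rightarrow> bool. \<forall>a\<in>T. \<forall>b\<in>T. P a b \<longrightarrow> col a \<noteq> col b"
  using assms
\<comment> \<open>Negating \<open>f\<close> inserts the elements by decreasing \<open>f\<close>.
  Arcs of \<open>P\<close> then lead from elements already coloured to the new one and never back;
  the new element has at most one in-neighbour, whose colour is avoided.\<close>
proof (induction T rule: finite_ranking_induct[where f = "\<lambda>x. - int (f x)"])
  case (insert x S)
  then obtain col :: "'a \<Rightarrow> bool" where col: "\<forall>a\<in>S. \<forall>b\<in>S. P a b \<longrightarrow> col a \<noteq> col b"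
  proof -
    have "f b < f a" if "a \<in> S" "b \<in> S" "P a b" for a b
      using insert.prems(1)[of a b] that by simp
    moreover have "a = b" if "a \<in> S" "b \<in> S" "c \<in> S" "P a c" "P b c" for a b c
      using insert.prems(2)[of a b c] that by simp
    ultimately show thesis using insert.IH that by presburger
  qed
  show ?case
  proof (cases "x \<in> S")
    case True
    then show ?thesis using col by (auto simp: insert_absorb)
  next
    case False
    define c where "c \<longleftrightarrow> (\<forall>a\<in>S. P a x \<longrightarrow> \<not> col a)"
    have no: "\<not> P x b" if "b \<in> insert x S" for b
      using insert.prems(1)[of x b] insert.hyps(2)[of b] that by (cases "b = x") auto
    have "c \<noteq> col a" if "a \<in> S" "P a x" for a
      using insert.prems(2)[of a _ x] that by (auto simp: c_def)
    then have "\<forall>a\<in>insert x S. \<forall>b\<in>insert x S. P a b \<longrightarrow> (col(x := c)) a \<noteq> (col(x := c)) b"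
      using no col False by (metis fun_upd_apply insert_iff)
    then show ?thesis by blast
  qed
qed simp

lemma connected_on_crossing_edge:
  assumes "connected_on E Y" "A \<subseteq> Y" "A \<noteq> {}" "A \<noteq> Y"
  shows "\<exists>a\<in>A. \<exists>b\<in>Y - A. E a b"
proof (rule ccontr)
  assume no: "\<not> ?thesis"
  obtain a b where ab: "a \<in> A" "b \<in> Y" "b \<notin> A" using assms by blast
  then have "(a, b) \<in> (induced_arcs E Y)\<^sup>*" using assms by (auto simp: connected_on_def)
  then have "b \<in> A"
    by (induction rule: rtrancl_induct) (use ab no in \<open>auto simp: induced_arcs_def\<close>)
  then show False using ab by simp
qed

lemma rtrancl_induced_arcs_sym:
  assumes "symp E" "(u, v) \<in> (induced_arcs E X)\<^sup>*"
  shows "(v, u) \<in> (induced_arcs E X)\<^sup>*"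
proof -
  have "sym (induced_arcs E X)" using sympD[OF assms(1)] by (auto simp: sym_def induced_arcs_def)
  from sym_rtrancl[OF this] show ?thesis using assms(2) by (auto dest: symD)
qed

lemma connected_onI:
  assumes "symp E" "r \<in> X" "\<And>x. x \<in> X \<Longrightarrow> (r, x) \<in> (induced_arcs E X)\<^sup>*"
  shows "connected_on E X"
  unfolding connected_on_def
proof (intro conjI ballI)
  fix u v assume "u \<in> X" "v \<in> X"
  have "(u, r) \<in> (induced_arcs E X)\<^sup>*"
    by (rule rtrancl_induced_arcs_sym[OF assms(1) assms(3)[OF \<open>u \<in> X\<close>]])
  then show "(u, v) \<in> (induced_arcs E X)\<^sup>*"
    using assms(3)[OF \<open>v \<in> X\<close>] by (rule rtrancl_trans)
qed (use assms(2) in blast)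

text \<open>
  For a minimal \<open>T\<close>, let \<open>D t\<close> be the part of \<open>S \<union> T\<close> that \<open>t\<close> separates from a fixed root and
  \<open>y t\<close> a neighbour of \<open>t\<close> in it. The edges \<open>(y t, t)\<close> can violate inducedness only if
  \<open>y t\<close> is adjacent to another element \<open>u\<close> of \<open>T\<close>, and every \<open>u\<close> has at most one such \<open>t\<close>.
\<close>

lemma connecting_set_bound:
  assumes fin: "finite X" and con: "connected_on E X" and "S \<subseteq> X" and ind: "independent E (X - S)"
    and "symp E"
  shows "\<exists>T M. T \<subseteq> X - S \<and> connected_on E (S \<union> T) \<and> M \<subseteq> X \<times> X \<and> induced_matching E M \<and>
    (card T \<le> 2 * card M \<or> card T \<le> 1)"
proof -
  note sym = sympD[OF \<open>symp E\<close>]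
  let ?Q = "\<lambda>T. T \<subseteq> X - S \<and> connected_on E (S \<union> T)"
  have "?Q (X - S)" using assms by (simp add: Un_absorb1)
  from ex_has_least_nat[of ?Q, OF this, of card] obtain T where T: "T \<subseteq> X - S" "connected_on E (S \<union> T)"
    and min: "\<And>T'. T' \<subseteq> X - S \<Longrightarrow> connected_on E (S \<union> T') \<Longrightarrow> card T \<le> card T'"
    by blast
  have finT: "finite T" using T(1) fin by (meson finite_Diff finite_subset)
  have indT: "\<And>t u. t \<in> T \<Longrightarrow> u \<in> T \<Longrightarrow> \<not> E t u" using ind T(1) by (auto simp: independent_def)
  show ?thesis
  proof (cases "S = {}")
    \<comment> \<open>Without \<open>S\<close> there is no root. But then the independent set
      \<open>T\<close> is connected, hence a single vertex: this is the origin of the alternative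
      \<open>card T \<le> 1\<close>.\<close>
    case True
    have "induced_arcs E T = {}" using indT by (auto simp: induced_arcs_def)
    then have "\<forall>t\<in>T. \<forall>u\<in>T. t = u" using T(2) True by (auto simp: connected_on_def)
    then have "card T \<le> 1" using finT card_le_Suc0_iff_eq by auto
    moreover have "induced_matching E {}" by (simp add: induced_matching_def)
    ultimately show ?thesis using T by blast
  next
    case False
    then obtain r where r: "r \<in> S" by blast
    define Y where "Y = S \<union> T"
    have finY: "finite Y" "Y \<subseteq> X" using T(1) fin \<open>S \<subseteq> X\<close> by (auto simp: Y_def intro: finite_subset)
    have conY: "connected_on E Y" using T by (simp add: Y_def)
    define R where "R t = {x. (r, x) \<in> (induced_arcs E (Y - {t}))\<^sup>*}" for t
    define D where "D t = Y - {t} - R t" for t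
    have rR: "r \<in> R t" for t by (simp add: R_def)
    have RY: "x \<in> Y - {t}" if "x \<in> R t" "t \<in> T" for t x
    proof -
      have "r \<in> Y - {t}" using r T(1) that(2) by (auto simp: Y_def)
      moreover have "(r, x) \<in> (induced_arcs E (Y - {t}))\<^sup>*" using that by (simp add: R_def)
      ultimately show ?thesis by (auto elim: rtranclE simp: induced_arcs_def)
    qed
    have Rstep: "b \<in> R t" if "a \<in> R t" "b \<in> Y" "E a b" "b \<noteq> t" "t \<in> T" for a b t
    proof -
      have "(a, b) \<in> induced_arcs E (Y - {t})" using that RY by (auto simp: induced_arcs_def)
      then show ?thesis using that(1) by (auto simp: R_def intro: rtrancl_into_rtrancl)
    qed
    have Dstep: "b \<in> D t" if "a \<in> D t" "b \<in> Y" "E a b" "b \<noteq> t" "t \<in> T" for a b t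
      using that Rstep[of b t a] sym[OF that(3)] by (auto simp: D_def)
    \<comment> \<open>Minimality is used here: if \<open>t\<close> separated nothing from the root,
      \<open>T - {t}\<close> would do.\<close>
    have Dne: "D t \<noteq> {}" if t: "t \<in> T" for t
    proof
      assume "D t = {}"
      then have a: "\<And>x. x \<in> Y - {t} \<Longrightarrow> (r, x) \<in> (induced_arcs E (Y - {t}))\<^sup>*"
        by (auto simp: D_def R_def)
      have "connected_on E (Y - {t})"
        by (rule connected_onI[OF \<open>symp E\<close> RY[OF rR t] a])
      moreover have "Y - {t} = S \<union> (T - {t})" using T(1) t by (auto simp: Y_def)
      ultimately have "card T \<le> card (T - {t})" using T(1) by (intro min) auto
      then show False using t finT by (metis card_Diff1_less not_le)
    qed
    \<comment> \<open>An edge leaving \<open>D t\<close> can only end in \<open>t\<close>, and its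
      end in \<open>D t\<close> is not in \<open>T\<close> because \<open>T\<close> is
      independent.\<close>
    have "\<exists>y. y \<in> D t \<and> y \<in> S \<and> E y t" if t: "t \<in> T" for t
    proof -
      have "D t \<subseteq> Y" "D t \<noteq> Y" using rR r by (auto simp: D_def Y_def)
      from connected_on_crossing_edge[OF conY this(1) Dne[OF t] this(2)]
      obtain a b where ab: "a \<in> D t" "b \<in> Y" "b \<notin> D t" "E a b" by blast
      then have "b = t" using Dstep t by blast
      moreover have "a \<notin> T" using ab indT t \<open>b = t\<close> by blast
      ultimately show ?thesis using ab by (auto simp: D_def Y_def)
    qed
    then obtain y where y: "\<And>t. t \<in> T \<Longrightarrow> y t \<in> D t" "\<And>t. t \<in> T \<Longrightarrow> y t \<in> S"
      "\<And>t. t \<in> T \<Longrightarrow> E (y t) t" by metis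
    have TY: "t \<in> Y" "t \<notin> S" if "t \<in> T" for t using that T(1) by (auto simp: Y_def)
    have yY: "y t \<in> Y" "y t \<noteq> u" if "t \<in> T" "u \<in> T" for t u
      using y(2)[OF that(1)] TY[OF that(2)] by (auto simp: Y_def)
    \<comment> \<open>As in a dominator tree: if \<open>t\<close> separates \<open>u\<close> from
      the root, then walks from the root that avoid \<open>t\<close> also avoid \<open>u\<close>,
      and \<open>t\<close> can be reached without \<open>u\<close>. So \<open>D u\<close> is a
      proper part of \<open>D t\<close>, and \<open>card (D t)\<close> is a rank for the
      conflicts.\<close>
    have dom: "R t \<subseteq> R u" "t \<in> R u" if "t \<in> T" "u \<in> T" "u \<in> D t" for t u
    proof -
      show "R t \<subseteq> R u"
      proof
        fix x assume "x \<in> R t"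
        then have "(r, x) \<in> (induced_arcs E (Y - {t}))\<^sup>*" by (simp add: R_def)
        then have "x \<in> R t \<and> x \<in> R u"
        proof (induction rule: rtrancl_induct)
          case base
          then show ?case using rR by simp
        next
          case (step a b)
          then have b: "b \<in> Y" "E a b" "b \<noteq> t" by (auto simp: induced_arcs_def)
          then have "b \<in> R t" using Rstep step that by blast
          moreover have "b \<noteq> u" using \<open>b \<in> R t\<close> that by (auto simp: D_def)
          ultimately show ?case using Rstep b step that by blast
        qed
        then show "x \<in> R u" by simp
      qed
      have "R t \<subseteq> Y" "R t \<noteq> Y" using RY[OF _ that(1)] TY[OF that(1)] by auto
      from connected_on_crossing_edge[OF conY this(1) _ this(2)] rR
      obtain a b where ab: "a \<in> R t" "b \<in> Y" "b \<notin> R t" "E a b" by blast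
      then have "b = t" using Rstep that by blast
      moreover have "t \<noteq> u" using that by (auto simp: D_def)
      ultimately show "t \<in> R u" using Rstep[of a u b] ab \<open>R t \<subseteq> R u\<close> that by blast
    qed
    have anti: "t \<notin> D u" if "t \<in> T" "u \<in> T" "u \<in> D t" for t u
      using dom(2)[OF that] by (simp add: D_def)
    have less: "card (D u) < card (D t)" if "t \<in> T" "u \<in> T" "u \<in> D t" for t u
    proof (rule psubset_card_mono)
      show "finite (D t)" using finY by (simp add: D_def)
      show "D u \<subset> D t" using dom[OF that] that(3) by (auto simp: D_def)
    qed
    let ?P = "\<lambda>t u. t \<noteq> u \<and> E (y t) u"
    have PD: "u \<in> D t" if "t \<in> T" "u \<in> T" "?P t u" for t u
      using Dstep[OF y(1)[OF that(1)] TY(1)[OF that(2)]] that by auto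
    \<comment> \<open>If \<open>y t\<close> and \<open>y u\<close> were both adjacent to
      \<open>v\<close>, then \<open>v\<close>, from there \<open>y u\<close>, and then
      \<open>u\<close> would lie in \<open>D t\<close>. By symmetry \<open>t\<close> would lie in
      \<open>D u\<close>, contradicting \<open>anti\<close>.\<close>
    have uniq: "t = u" if "t \<in> T" "u \<in> T" "v \<in> T" "?P t v" "?P u v" for t u v
    proof (rule ccontr)
      assume tu: "t \<noteq> u"
      have *: "b \<in> D a" if ab: "a \<in> T" "b \<in> T" "?P a v" "?P b v" "a \<noteq> b" for a b
      proof -
        have "y b \<in> D a"
          using Dstep[OF PD[OF ab(1) \<open>v \<in> T\<close> ab(3)] yY(1)[OF ab(2,1)]] ab sym yY(2) by blast
        then show ?thesis using Dstep[OF _ TY(1)[OF ab(2)] y(3)[OF ab(2)]] ab by blast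
      qed
      show False using *[of t u] *[of u t] that tu anti[of t u] by auto
    qed
    have "\<exists>col :: 'a \<Rightarrow> bool. \<forall>t\<in>T. \<forall>u\<in>T. ?P t u \<longrightarrow> col t \<noteq> col u"
    proof (rule indegree_one_two_colouring[where f = "\<lambda>t. card (D t)"])
      show "card (D u) < card (D t)" if "t \<in> T" "u \<in> T" "?P t u" for t u
        by (rule less[OF that(1,2) PD[OF that]])
      show "t = u" if "t \<in> T" "u \<in> T" "v \<in> T" "?P t v" "?P u v" for t u v
        by (rule uniq[OF that])
    qed (rule finT)
    then obtain col :: "'a \<Rightarrow> bool" where col: "\<forall>t\<in>T. \<forall>u\<in>T. ?P t u \<longrightarrow> col t \<noteq> col u"
      by (elim exE)
    have matching: "\<exists>M. M \<subseteq> X \<times> X \<and> induced_matching E M \<and> card M = card C"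
      if C: "C \<subseteq> T" and mono: "\<And>t u. t \<in> C \<Longrightarrow> u \<in> C \<Longrightarrow> col t = col u" for C
    proof -
      let ?M = "(\<lambda>t. (y t, t)) ` C"
      have "card ?M = card C" by (rule card_image) (auto simp: inj_on_def)
      moreover have "?M \<subseteq> X \<times> X" using C y(2) \<open>S \<subseteq> X\<close> T(1) by auto
      moreover have "induced_matching E ?M"
      proof -
        \<comment> \<open>A colour class contains no conflict. Vertices \<open>y t\<close> and
          \<open>y u\<close> that coincide or are adjacent would again put \<open>u\<close> into
          \<open>D t\<close> and \<open>t\<close> into \<open>D u\<close>.\<close>
        have sep: "y t \<noteq> y u \<and> \<not> E (y t) (y u) \<and> \<not> E (y t) u \<and> \<not> E t (y u) \<and> \<not> E t u \<and> y t \<noteq> u \<and> t \<noteq> y u"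
          if tu: "t \<in> C" "u \<in> C" "t \<noteq> u" for t u
        proof -
          have T: "t \<in> T" "u \<in> T" using C tu by auto
          have no: "\<not> E (y a) b" if "a \<in> C" "b \<in> C" "a \<noteq> b" for a b
            using col mono that C by blast
          have D: "b \<in> D a" if "a \<in> T" "b \<in> T" "a \<noteq> b" "y a = y b \<or> E (y a) (y b)" for a b
          proof -
            have "y b \<in> D a" using that Dstep[OF y(1)[OF that(1)] yY(1)[OF that(2,1)]] yY(2) y(1)[OF that(1)] by metis
            then show ?thesis using Dstep[OF _ TY(1)[OF that(2)] y(3)[OF that(2)]] that by blast
          qed
          have "\<not> (y t = y u \<or> E (y t) (y u))"
            using D[of t u] D[of u t] anti[of t u] T tu(3) sym by metis
          then show ?thesis using no[of t u] no[of u t] tu sym indT yY(2) T by metis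
        qed
        have "\<forall>x\<in>{fst p, snd p}. \<forall>x'\<in>{fst q, snd q}. x \<noteq> x' \<and> \<not> E x x'"
          if "p \<in> ?M" "q \<in> ?M" "p \<noteq> q" for p q
        proof -
          obtain t u where tu: "p = (y t, t)" "q = (y u, u)" "t \<in> C" "u \<in> C" using \<open>p \<in> ?M\<close> \<open>q \<in> ?M\<close> by blast
          moreover have "t \<noteq> u" using tu \<open>p \<noteq> q\<close> by blast
          ultimately show ?thesis using sep[of t u] by simp
        qed
        moreover have "\<forall>(a, b)\<in>?M. E a b" using y(3) C by auto
        ultimately show ?thesis unfolding induced_matching_def by blast
      qed
      ultimately show ?thesis by blast
    qed
    let ?C = "{t\<in>T. col t}" and ?C' = "{t\<in>T. \<not> col t}"
    have sum: "card T = card ?C + card ?C'"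
      by (subst card_Un_disjoint[symmetric]) (use finT in \<open>auto intro: arg_cong[where f = card]\<close>)
    have "\<exists>M. M \<subseteq> X \<times> X \<and> induced_matching E M \<and> card M = card ?C"
      by (rule matching) auto
    then obtain M where M: "M \<subseteq> X \<times> X" "induced_matching E M" "card M = card ?C"
      by (elim exE conjE)
    have "\<exists>M. M \<subseteq> X \<times> X \<and> induced_matching E M \<and> card M = card ?C'"
      by (rule matching) auto
    then obtain M' where M': "M' \<subseteq> X \<times> X" "induced_matching E M'" "card M' = card ?C'"
      by (elim exE conjE)
    have "card T \<le> 2 * card M \<or> card T \<le> 2 * card M'" using sum M(3) M'(3) by linarith
    then have "\<exists>M. M \<subseteq> X \<times> X \<and> induced_matching E M \<and> card T \<le> 2 * card M"
      using M(1,2) M'(1,2) by blast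
    then show ?thesis using T by blast
  qed
qed

section \<open>Graphs without induced copies of an edge\<close>

text \<open>\<open>digraph_iso\<close> asks for an isomorphism from the induced subgraph onto
  \<open>H\<close>, so its vertex map is the inverse \<open>\<phi>\<close> of \<open>\<psi>\<close>;
  on arcs, which are pairs, it acts componentwise.\<close>

lemma not_induced_free_if_embedding:
  assumes "pair_wf_digraph G" "pair_wf_digraph H"
    and inj: "inj_on \<psi> (pverts H)" and "\<psi> ` pverts H \<subseteq> pverts G"
    and arcs: "\<And>x y. x \<in> pverts H \<Longrightarrow> y \<in> pverts H \<Longrightarrow> (\<psi> x, \<psi> y) \<in> parcs G \<longleftrightarrow> (x, y) \<in> parcs H"
  shows "\<not> induced_free H G"
proof -
  define K where "K = with_proj G \<restriction> (\<psi> ` pverts H)"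
  define \<phi> where "\<phi> = the_inv_into (pverts H) \<psi>"
  define f :: "('a, 'a \<times> 'a, 'b, 'b \<times> 'b) digraph_isomorphism" where
    "f = \<lparr>iso_verts = \<phi>, iso_arcs = map_prod \<phi> \<phi>, iso_head = snd, iso_tail = fst\<rparr>"
  have \<phi>: "\<phi> (\<psi> x) = x" if "x \<in> pverts H" for x
    using the_inv_into_f_f[OF inj that] by (simp add: \<phi>_def)
  have wf: "wf_digraph (with_proj G)" using assms(1) by (simp add: wf_digraph_wp_iff)
  have K: "induced_subgraph K (with_proj G)"
    unfolding K_def using wf_digraph.induced_induce[OF wf] assms(4) by simp
  have wfK: "wf_digraph K" using K by (auto simp: induced_subgraph_def subgraph_def)
  have Kv: "verts K = \<psi> ` pverts H" by (simp add: K_def)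
  have Ka: "arcs K = map_prod \<psi> \<psi> ` parcs H" (is "?L = ?R")
  proof
    show "?L \<subseteq> ?R"
    proof
      fix e assume "e \<in> ?L"
      then obtain x y where "e = (\<psi> x, \<psi> y)" "e \<in> parcs G" "x \<in> pverts H" "y \<in> pverts H"
        by (cases e) (auto simp: K_def)
      then show "e \<in> ?R" using arcs[of x y] by force
    qed
    show "?R \<subseteq> ?L"
    proof
      fix e assume "e \<in> ?R"
      then obtain x y where xy: "e = (\<psi> x, \<psi> y)" "(x, y) \<in> parcs H" by auto
      moreover have "x \<in> pverts H" "y \<in> pverts H"
        using pair_wf_digraph.in_arcsD1[OF assms(2) xy(2)] pair_wf_digraph.in_arcsD2[OF assms(2) xy(2)]
        by auto
      ultimately show "e \<in> ?L" using arcs[of x y] by (auto simp: K_def)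
    qed
  qed
  have \<phi>\<psi>: "\<phi> ` \<psi> ` pverts H = pverts H" using \<phi> by force
  have H: "x \<in> pverts H" "y \<in> pverts H" if "(x, y) \<in> parcs H" for x y
    using pair_wf_digraph.in_arcsD1[OF assms(2) that] pair_wf_digraph.in_arcsD2[OF assms(2) that] by auto
  have arcs': "map_prod \<phi> \<phi> ` map_prod \<psi> \<psi> ` parcs H = parcs H"
  proof -
    have "map_prod \<phi> \<phi> (map_prod \<psi> \<psi> e) = e" if "e \<in> parcs H" for e
      using that \<phi> H by (cases e) auto
    then show ?thesis by (simp add: image_image)
  qed
  have "pre_digraph.digraph_isomorphism K f"
    unfolding pre_digraph.digraph_isomorphism_def
  proof (intro conjI ballI)
    show "inj_on (iso_verts f) (verts K)" using \<phi> by (auto simp: f_def Kv intro!: inj_onI)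
    show "inj_on (iso_arcs f) (arcs K)" using \<phi> H by (auto simp: f_def Ka intro!: inj_onI)
  qed (use wfK in \<open>auto simp: f_def K_def\<close>)
  moreover have "with_proj H = app_iso f K"
    by (simp add: app_iso_def with_proj_def f_def Kv Ka \<phi>\<psi> arcs')
  ultimately show ?thesis
    unfolding induced_free_def digraph_iso_def using K by blast
qed

lemma copies_P2_simps:
  "pverts (copies s P2) = {..<s} \<times> UNIV"
  "((i, b), (j, c)) \<in> parcs (copies s P2) \<longleftrightarrow> i < s \<and> i = j \<and> b \<noteq> c"
  by (auto simp: copies_def P2_def UNIV_bool)

text \<open>Sending the \<open>i\<close>-th copy of the edge to the \<open>i\<close>-th of
  \<open>s\<close> chosen pairs would embed the forbidden graph.\<close>

lemma induced_matching_card_less: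
  assumes G: "pair_graph G" and free: "induced_free (copies s P2) G"
    and M: "M \<subseteq> pverts G \<times> pverts G" "induced_matching (\<lambda>u v. (u, v) \<in> parcs G) M"
  shows "card M < s"
proof (rule ccontr)
  assume "\<not> card M < s"
  then obtain N where N: "N \<subseteq> M" "card N = s" "finite N"
    by (metis not_le obtain_subset_with_card_n linorder_not_less)
  interpret pair_graph G by fact
  have loop: "(u, u) \<notin> parcs G" for u using pair_no_loops[of "(u, u)"] by auto
  have sym: "(u, v) \<in> parcs G \<Longrightarrow> (v, u) \<in> parcs G" for u v
    using pair_sym_arcs by (auto simp: symmetric_def dest: symD)
  obtain h where h: "bij_betw h {0..<s} N" using ex_bij_betw_nat_finite[OF N(3)] N(2) by auto
  define \<psi> where "\<psi> = (\<lambda>(i, b). if b then snd (h i) else fst (h i))"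
  have hM: "h i \<in> M" if "i < s" for i using bij_betwE[OF h] that N(1) by auto
  have hne: "h i \<noteq> h j" if "i < s" "j < s" "i \<noteq> j" for i j
    using h that by (auto simp: bij_betw_def inj_on_def)
  have diff: "\<psi> (i, b) \<noteq> \<psi> (j, c) \<and> (\<psi> (i, b), \<psi> (j, c)) \<notin> parcs G" if "i < s" "j < s" "i \<noteq> j" for i j b c
  proof -
    from M(2) have "\<forall>p\<in>M. \<forall>q\<in>M. p \<noteq> q \<longrightarrow>
        (\<forall>x\<in>{fst p, snd p}. \<forall>y\<in>{fst q, snd q}. x \<noteq> y \<and> (x, y) \<notin> parcs G)"
      unfolding induced_matching_def by (rule conjunct2)
    then have "\<forall>x\<in>{fst (h i), snd (h i)}. \<forall>y\<in>{fst (h j), snd (h j)}. x \<noteq> y \<and> (x, y) \<notin> parcs G"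
      using hM[OF that(1)] hM[OF that(2)] hne[OF that] by blast
    moreover have "\<psi> (i, b) \<in> {fst (h i), snd (h i)}" "\<psi> (j, c) \<in> {fst (h j), snd (h j)}"
      by (simp_all add: \<psi>_def)
    ultimately show ?thesis by blast
  qed
  have edge: "(fst (h i), snd (h i)) \<in> parcs G" if "i < s" for i
    using M(2) hM[OF that] by (auto simp: induced_matching_def)
  have same: "(\<psi> (i, b), \<psi> (i, c)) \<in> parcs G \<longleftrightarrow> b \<noteq> c" if "i < s" for i b c
    using edge[OF that] sym loop by (auto simp: \<psi>_def)
  have "\<not> induced_free (copies s P2) G"
  proof (rule not_induced_free_if_embedding)
    show "pair_wf_digraph G" by unfold_locales
    show "pair_wf_digraph (copies s P2)"
      by unfold_locales (auto simp: copies_P2_simps)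
    show "inj_on \<psi> (pverts (copies s P2))"
    proof (rule inj_onI)
      fix x y assume xy: "x \<in> pverts (copies s P2)" "y \<in> pverts (copies s P2)" "\<psi> x = \<psi> y"
      then obtain i b j c where e: "x = (i, b)" "y = (j, c)" "i < s" "j < s"
        by (cases x, cases y) (auto simp: copies_P2_simps)
      then have "i = j" using diff[of i j b c] xy(3) by auto
      moreover have "b = c" using same[of i b c] e xy(3) loop \<open>i = j\<close> by auto
      ultimately show "x = y" using e by simp
    qed
    show "\<psi> ` pverts (copies s P2) \<subseteq> pverts G"
    proof
      fix v assume "v \<in> \<psi> ` pverts (copies s P2)"
      then obtain i b where "v = \<psi> (i, b)" "i < s" by (auto simp: copies_P2_simps)
      then show "v \<in> pverts G" using hM[of i] M(1) by (auto simp: \<psi>_def)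
    qed
    fix x y assume "x \<in> pverts (copies s P2)" "y \<in> pverts (copies s P2)"
    then obtain i b j c where e: "x = (i, b)" "y = (j, c)" "i < s" "j < s"
      by (cases x, cases y) (auto simp: copies_P2_simps)
    then show "(\<psi> x, \<psi> y) \<in> parcs G \<longleftrightarrow> (x, y) \<in> parcs (copies s P2)"
      using diff[of i j b c] same[of i b c] by (cases "i = j") (auto simp: copies_P2_simps)
  qed
  then show False using free by simp
qed

text \<open>The library's connectedness passes through a symmetric closure and through reachability
  restricted to the vertex set. Here the arcs are already symmetric, and walks along
  \<open>induced_arcs\<close> that start in \<open>S\<close> stay in \<open>S\<close>, so the plain
  reflexive transitive closure agrees with it.\<close>

lemma connected_vertex_cover_iff:
  assumes "pair_graph G"
  shows "connected_vertex_cover G S \<longleftrightarrow> S \<subseteq> pverts G \<and>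
    (\<forall>(u, v)\<in>parcs G. u \<in> S \<or> v \<in> S) \<and> connected_on (\<lambda>u v. (u, v) \<in> parcs G) S"
proof -
  interpret pair_graph G by fact
  have sym: "(u, v) \<in> parcs G \<Longrightarrow> (v, u) \<in> parcs G" for u v
    using pair_sym_arcs by (auto simp: symmetric_def dest: symD)
  let ?H = "mk_symmetric (with_proj G \<restriction> S)"
  let ?R = "induced_arcs (\<lambda>u v. (u, v) \<in> parcs G) S"
  have arcs: "parcs ?H = ?R"
    using sym by (auto simp: parcs_mk_symmetric induced_arcs_def)
  have "u \<rightarrow>\<^sup>*\<^bsub>with_proj ?H\<^esub> v \<longleftrightarrow> (u, v) \<in> ?R\<^sup>*" if "u \<in> S" for u v
  proof
    assume "u \<rightarrow>\<^sup>*\<^bsub>with_proj ?H\<^esub> v"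
    then have "(u, v) \<in> rtrancl_on S ?R" by (simp add: reachable_def arcs)
    then show "(u, v) \<in> ?R\<^sup>*"
      by (induction rule: rtrancl_on_induct) (auto intro: rtrancl_into_rtrancl)
  next
    assume "(u, v) \<in> ?R\<^sup>*"
    then have "(u, v) \<in> rtrancl_on S ?R"
    proof (induction rule: rtrancl_induct)
      case (step y z)
      then show ?case by (auto intro: rtrancl_on_into_rtrancl_on simp: induced_arcs_def)
    qed (use that in simp)
    then show "u \<rightarrow>\<^sup>*\<^bsub>with_proj ?H\<^esub> v" by (simp add: reachable_def arcs)
  qed
  then have "Digraph_Component.connected (with_proj G \<restriction> S) \<longleftrightarrow>
      connected_on (\<lambda>u v. (u, v) \<in> parcs G) S"
    by (auto simp: Digraph_Component.connected_def strongly_connected_def connected_on_def)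
  then show ?thesis by (auto simp: connected_vertex_cover_def vertex_cover_def)
qed

text \<open>Tuples have a fixed length, while the sets that they list may be smaller. Spare
  positions repeat an element, so there has to be one.\<close>

lemma ex_surjection_from_initial_segment:
  fixes A :: "'a set"
  assumes "finite A" "A \<noteq> {}" "card A \<le> k"
  shows "\<exists>f. f ` {..<k} = A"
proof -
  obtain h where h: "bij_betw h {0..<card A} A" using ex_bij_betw_nat_finite[OF assms(1)] by blast
  have c: "0 < card A" using assms by (simp add: card_gt_0_iff)
  let ?f = "\<lambda>i. h (if i < card A then i else 0)"
  have "?f ` {..<k} = h ` {0..<card A}"
  proof (rule equalityI)
    show "?f ` {..<k} \<subseteq> h ` {0..<card A}" using c by auto
    show "h ` {0..<card A} \<subseteq> ?f ` {..<k}"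
    proof
      fix x assume "x \<in> h ` {0..<card A}"
      then obtain i where "x = h i" "i < card A" by auto
      then show "x \<in> ?f ` {..<k}" using assms(3) by (intro image_eqI[of _ _ i]) auto
    qed
  qed
  also have "\<dots> = A" using h by (simp add: bij_betw_def)
  finally show ?thesis by (rule exI[of _ ?f])
qed

text \<open>The formula of \<open>maximal_independent_greedy\<close> for \<open>s\<close> indexed
  pairs. Its right-hand side consults \<open>I\<close> only below \<open>v\<close>, so it is a
  recursion along the order that makes sense for arbitrary tuples; the resulting set may fail to be
  independent.\<close>

definition greedy_set :: "('a :: linorder \<Rightarrow> 'a \<Rightarrow> bool) \<Rightarrow> nat \<Rightarrow> (nat \<Rightarrow> 'a) \<Rightarrow> (nat \<Rightarrow> 'a) \<Rightarrow> 'a set \<Rightarrow> 'a set \<Rightarrow> bool" where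
  "greedy_set E s w j A I \<longleftrightarrow> I \<subseteq> A \<and> (\<forall>v\<in>A. v \<in> I \<longleftrightarrow> (\<exists>i<s. v = j i) \<or>
     ((\<forall>u\<in>I. u < v \<longrightarrow> \<not> E v u) \<and> (\<forall>i<s. v < j i \<longrightarrow> v \<noteq> w i \<and> \<not> E v (w i) \<and> \<not> E v (j i))))"

text \<open>Uniqueness lets the set computed by the program stand for the \<open>I\<close> that a
  witness describes.\<close>

lemma greedy_set_unique:
  fixes A :: "'a :: wellorder set"
  assumes "greedy_set E s w j A I" "greedy_set E s w j A J"
  shows "I = J"
proof -
  have "v \<in> A \<Longrightarrow> v \<in> I \<longleftrightarrow> v \<in> J" for v
  proof (induction v rule: less_induct)
    case (less v)
    have "I \<subseteq> A" "J \<subseteq> A" using assms by (auto simp: greedy_set_def)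
    then have "(\<forall>u\<in>I. u < v \<longrightarrow> \<not> E v u) \<longleftrightarrow> (\<forall>u\<in>J. u < v \<longrightarrow> \<not> E v u)"
      using less.IH by (meson subsetD)
    then show ?case using assms less.prems unfolding greedy_set_def by simp
  qed
  then show ?thesis using assms unfolding greedy_set_def by blast
qed

text \<open>Completeness of the search. \<open>connecting_set_bound\<close> is applied inside
  \<open>S\<close>, not inside the whole graph; this keeps the described cover within
  \<open>S\<close> and bounds its size.\<close>

lemma connected_vertex_cover_code:
  fixes G :: "nat pair_pre_digraph"
  defines "E \<equiv> \<lambda>u v. (u, v) \<in> parcs G"
  assumes G: "pair_graph G" and n: "pverts G = {..<n}" and free: "induced_free (copies s P2) G"
    and "s \<ge> 1" and S: "connected_vertex_cover G S"
  shows "\<exists>w j t I. (\<forall>i<s. w i < n \<and> j i < n) \<and> (\<forall>i<2*s. t i < n) \<and> greedy_set E s w j {..<n} I \<and>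
    connected_vertex_cover G {v. v < n \<and> (v \<notin> I \<or> (\<exists>i<2*s. v = t i))} \<and>
    card {v. v < n \<and> (v \<notin> I \<or> (\<exists>i<2*s. v = t i))} \<le> card S"
proof -
  interpret pair_graph G by fact
  have irrefl: "\<not> E u u" for u using pair_no_loops[of "(u, u)"] by (auto simp: E_def)
  have sym: "symp E"
    using pair_sym_arcs by (auto simp: symmetric_def E_def symp_def dest: symD)
  have S': "S \<subseteq> {..<n}" "\<And>u v. E u v \<Longrightarrow> u \<in> S \<or> v \<in> S" "connected_on E S"
    using S connected_vertex_cover_iff[OF G, of S] n by (auto simp: E_def)
  have EV: "u < n" "v < n" if "E u v" for u v
    using in_arcsD1[of u v] in_arcsD2[of u v] that n by (auto simp: E_def)
  have finS: "finite S" using S'(1) by (rule finite_subset) simp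
  have matching: "card M < s" if "M \<subseteq> {..<n} \<times> {..<n}" "induced_matching E M" for M
    using induced_matching_card_less[OF G free, of M] that n by (simp add: E_def)
  have "independent E ({..<n} - S)" using S'(2) by (auto simp: independent_def)
  then obtain I where I: "{..<n} - S \<subseteq> I" "maximal_independent E {..<n} I"
    using maximal_independent_extension[of "{..<n}" "{..<n} - S" E] sym irrefl by auto
  then have In: "I \<subseteq> {..<n}" and indI: "independent E I" by (auto simp: maximal_independent_def)
  from maximal_independent_greedy[OF finite_lessThan I(2) sym]
  obtain M where M: "M \<subseteq> {..<n} \<times> {..<n}" "induced_matching E M" "snd ` M \<subseteq> I"
    and Mg: "\<forall>v\<in>{..<n}. v \<in> I \<longleftrightarrow> v \<in> snd ` M \<or> ((\<forall>u\<in>I. u < v \<longrightarrow> \<not> E v u) \<and>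
      (\<forall>(w, j)\<in>M. v < j \<longrightarrow> v \<noteq> w \<and> \<not> E v w \<and> \<not> E v j))"
    by (elim exE conjE)
  have n0: "0 < n" using S'(1,3) by (auto simp: connected_on_def)
  \<comment> \<open>An empty matching is padded with \<open>(0, 0)\<close>. This changes nothing:
    the greedy rule accepts 0 anyway, and no vertex is below 0.\<close>
  define M' where "M' = (if M = {} then {(0, 0)} else M)"
  have Mg': "\<forall>v\<in>{..<n}. v \<in> I \<longleftrightarrow> v \<in> snd ` M' \<or> ((\<forall>u\<in>I. u < v \<longrightarrow> \<not> E v u) \<and>
      (\<forall>(w, j)\<in>M'. v < j \<longrightarrow> v \<noteq> w \<and> \<not> E v w \<and> \<not> E v j))"
  proof (cases "M = {}")
    case True
    then show ?thesis using Mg by (auto simp: M'_def)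
  next
    case False
    then show ?thesis using Mg by (simp add: M'_def)
  qed
  have "finite M" using M(1) by (rule finite_subset) simp
  then have "finite M'" "M' \<noteq> {}" "card M' \<le> s" "M' \<subseteq> {..<n} \<times> {..<n}"
    using matching[OF M(1,2)] M(1) n0 \<open>s \<ge> 1\<close> by (auto simp: M'_def)
  then obtain f where f: "f ` {..<s} = M'" using ex_surjection_from_initial_segment by metis
  define w j where "w = fst \<circ> f" and "j = snd \<circ> f"
  have wj: "w i < n" "j i < n" if "i < s" for i
    using \<open>M' \<subseteq> _\<close> f that by (auto simp: w_def j_def)
  have 1: "v \<in> snd ` M' \<longleftrightarrow> (\<exists>i<s. v = j i)" for v
    by (auto simp: f[symmetric] j_def)
  have 2: "(\<forall>(w, j)\<in>M'. v < j \<longrightarrow> v \<noteq> w \<and> \<not> E v w \<and> \<not> E v j) \<longleftrightarrow>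
      (\<forall>i<s. v < j i \<longrightarrow> v \<noteq> w i \<and> \<not> E v (w i) \<and> \<not> E v (j i))" for v
    by (auto simp: f[symmetric] j_def w_def split_beta)
  have greedy: "greedy_set E s w j {..<n} I"
    using Mg' In unfolding greedy_set_def 1 2 by blast
  define S0 where "S0 = {..<n} - I"
  have "S0 \<subseteq> S" using I(1) by (auto simp: S0_def)
  have "independent E (S - S0)" using indI S'(1) by (auto simp: independent_def S0_def)
  from connecting_set_bound[OF finS S'(3) \<open>S0 \<subseteq> S\<close> this sym]
  obtain T N where T: "T \<subseteq> S - S0" "connected_on E (S0 \<union> T)"
    and N: "N \<subseteq> S \<times> S" "induced_matching E N" "card T \<le> 2 * card N \<or> card T \<le> 1"
    by (elim exE conjE)
  have "card N < s" using matching[of N] N S'(1) by blast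
  then have cT: "card T \<le> 2 * s" using N(3) \<open>s \<ge> 1\<close> by linarith
  have finT: "finite T" using T(1) finS by (meson finite_Diff finite_subset)
  obtain r where r: "r \<in> S0 \<union> T" using T(2) by (auto simp: connected_on_def)
  \<comment> \<open>If \<open>T\<close> is empty then \<open>r \<in> S0\<close>, so listing
    \<open>r\<close> leaves the cover unchanged.\<close>
  define T' where "T' = (if T = {} then {r} else T)"
  have "finite T'" "T' \<noteq> {}" "card T' \<le> 2 * s" and T': "S0 \<union> T' = S0 \<union> T"
    using finT cT r \<open>s \<ge> 1\<close> by (auto simp: T'_def)
  then obtain t where t: "t ` {..<2*s} = T'" using ex_surjection_from_initial_segment by metis
  have sub: "S0 \<union> T \<subseteq> S" using T \<open>S0 \<subseteq> S\<close> by auto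
  have eq: "{v. v < n \<and> (v \<notin> I \<or> (\<exists>i<2*s. v = t i))} = S0 \<union> T" (is "?A = _")
  proof -
    have "(\<exists>i<2*s. v = t i) \<longleftrightarrow> v \<in> T'" for v using t by auto
    then have "?A = {v. v < n \<and> v \<in> S0 \<union> T'}" by (auto simp: S0_def)
    also have "\<dots> = S0 \<union> T" unfolding T' using sub S'(1) by auto
    finally show ?thesis .
  qed
  have "t i < n" if "i < 2 * s" for i
  proof -
    have "t i \<in> S0 \<union> T" using t T' that by auto
    then show ?thesis using sub S'(1) by auto
  qed
  moreover have "connected_vertex_cover G (S0 \<union> T)"
    unfolding connected_vertex_cover_iff[OF G]
  proof (intro conjI)
    show "S0 \<union> T \<subseteq> pverts G" using sub S'(1) n by auto
    show "connected_on (\<lambda>u v. (u, v) \<in> parcs G) (S0 \<union> T)" using T(2) by (simp add: E_def)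
    have "u \<in> S0 \<or> v \<in> S0" if "E u v" for u v
      using that indI EV[OF that] by (auto simp: S0_def independent_def)
    then show "\<forall>(u, v)\<in>parcs G. u \<in> S0 \<union> T \<or> v \<in> S0 \<union> T" by (auto simp: E_def)
  qed
  moreover have "card (S0 \<union> T) \<le> card S" using finS sub by (rule card_mono)
  ultimately show ?thesis using wj greedy eq by (metis (no_types, lifting))
qed

section \<open>The program\<close>

definition holds :: "nat \<Rightarrow> exp \<Rightarrow> (nat \<Rightarrow> nat) \<Rightarrow> (nat \<Rightarrow> nat) \<Rightarrow> bool" where
  "holds L e \<eta> m \<longleftrightarrow> eval L e \<eta> m \<noteq> 0"

text \<open>Truth is being nonzero: truncated subtraction then decides the strict order, and a sum
  of naturals decides existence. \<open>Any\<close> and \<open>Every\<close> are unrolled when the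
  program is built; the lists they are applied to have lengths depending on \<open>s\<close>
  alone.\<close>

definition Neg :: "exp \<Rightarrow> exp" where "Neg e = Cond e (Num 0) (Num 1)"
definition And :: "exp \<Rightarrow> exp \<Rightarrow> exp" where "And a b = Cond a b (Num 0)"
definition Or :: "exp \<Rightarrow> exp \<Rightarrow> exp" where "Or a b = Cond a (Num 1) b"
definition Less :: "exp \<Rightarrow> exp \<Rightarrow> exp" where "Less a b = Minus b a"
definition Equal :: "exp \<Rightarrow> exp \<Rightarrow> exp" where "Equal a b = Neg (Or (Less a b) (Less b a))"
definition Exists :: "nat \<Rightarrow> exp \<Rightarrow> exp" where "Exists x e = Sum x e"
definition Forall :: "nat \<Rightarrow> exp \<Rightarrow> exp" where "Forall x e = Neg (Exists x (Neg e))"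
definition Any :: "exp list \<Rightarrow> exp" where "Any es = foldr Or es (Num 0)"
definition Every :: "exp list \<Rightarrow> exp" where "Every es = foldr And es (Num 1)"

lemma eval_Neg: "eval L (Neg e) \<eta> m = of_bool (\<not> holds L e \<eta> m)"
  by (simp add: Neg_def holds_def)

text \<open>\<open>num_verts\<close> adds up such values, so the exact value is needed and not
  merely its truth.\<close>

lemma eval_Forall: "eval L (Forall x e) \<eta> m = of_bool (\<forall>k<L. holds L e (\<eta>(x := k)) m)"
  by (auto simp: Forall_def Exists_def eval_Neg holds_def Neg_def)

lemma holds_simps [simp]:
  "holds L (Num c) \<eta> m \<longleftrightarrow> c \<noteq> 0"
  "holds L (Neg e) \<eta> m \<longleftrightarrow> \<not> holds L e \<eta> m"
  "holds L (And a b) \<eta> m \<longleftrightarrow> holds L a \<eta> m \<and> holds L b \<eta> m"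
  "holds L (Or a b) \<eta> m \<longleftrightarrow> holds L a \<eta> m \<or> holds L b \<eta> m"
  "holds L (Less a b) \<eta> m \<longleftrightarrow> eval L a \<eta> m < eval L b \<eta> m"
  "holds L (Equal a b) \<eta> m \<longleftrightarrow> eval L a \<eta> m = eval L b \<eta> m"
  "holds L (Exists x e) \<eta> m \<longleftrightarrow> (\<exists>k<L. holds L e (\<eta>(x := k)) m)"
  "holds L (Forall x e) \<eta> m \<longleftrightarrow> (\<forall>k<L. holds L e (\<eta>(x := k)) m)"
  "holds L (Fetch a) \<eta> m \<longleftrightarrow> m (eval L a \<eta> m) \<noteq> 0"
  by (auto simp: holds_def Neg_def And_def Or_def Less_def Equal_def Exists_def Forall_def)

lemma holds_Any [simp]: "holds L (Any es) \<eta> m \<longleftrightarrow> (\<exists>e\<in>set es. holds L e \<eta> m)"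
  by (induction es) (auto simp: Any_def)

lemma holds_Every [simp]: "holds L (Every es) \<eta> m \<longleftrightarrow> (\<forall>e\<in>set es. holds L e \<eta> m)"
  by (induction es) (auto simp: Every_def)

lemma run_For_invariant:
  assumes "P 0 m" and "\<And>k m. k < L \<Longrightarrow> P k m \<Longrightarrow> P (Suc k) (run L c (\<eta>(x := k)) m)"
  shows "P L (run L (For x c) \<eta> m)"
proof -
  have "j \<le> L \<Longrightarrow> P j (fold (\<lambda>k. run L c (\<eta>(x := k))) [0..<j] m)" for j
    by (induction j) (use assms in auto)
  then show ?thesis by simp
qed

text \<open>Variable \<open>0\<close> is never bound, so that it stands for the length of the input.\<close>

definition num_verts :: exp where
  "num_verts = Sum 1 (Forall 2 (Or (Less (Var 1) (Var 2)) (Fetch (Var 2))))"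

text \<open>The machine cannot multiply, so \<open>n\<close> is added in as many of the rounds as
  the value of \<open>e\<close> says. That value must not exceed the number of rounds, nor depend on
  variable 3, which is bound here.\<close>

definition times_num_verts :: "exp \<Rightarrow> exp" where
  "times_num_verts e = Sum 3 (Cond (Less (Var 3) e) num_verts (Num 0))"

definition vert :: "nat \<Rightarrow> exp" where
  "vert x = Less (Var x) num_verts"

text \<open>Variables run up to the input length, beyond the vertices; the guards keep the access
  from hitting unrelated cells.\<close>

definition edge :: "nat \<Rightarrow> nat \<Rightarrow> exp" where
  "edge x y = And (vert x) (And (vert y)
     (Fetch (Plus (Plus (Plus num_verts (Num 1)) (times_num_verts (Var x))) (Var y))))"

definition sign_address :: exp where
  "sign_address = Plus (Plus num_verts (Num 1)) (times_num_verts num_verts)"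

text \<open>Memory layout, for input length \<open>L\<close>: the input below \<open>L\<close>, the
  characteristic vector of \<open>I\<close> from \<open>L\<close>, the marks of reached vertices
  from \<open>2 * L\<close>, the bound at \<open>3 * L\<close>, the result at
  \<open>3 * L + 1\<close>.\<close>

definition indep_entry :: "nat \<Rightarrow> exp" where
  "indep_entry x = Plus (Var 0) (Var x)"

definition reach_entry :: "nat \<Rightarrow> exp" where
  "reach_entry x = Plus (Plus (Var 0) (Var 0)) (Var x)"

definition bound_cell :: exp where
  "bound_cell = Plus (Plus (Var 0) (Var 0)) (Var 0)"

definition found_cell :: exp where
  "found_cell = Plus bound_cell (Num 1)"

lemma eval_addresses [simp]:
  "eval L (indep_entry x) \<eta> m = \<eta> 0 + \<eta> x"
  "eval L (reach_entry x) \<eta> m = 2 * \<eta> 0 + \<eta> x"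
  "eval L bound_cell \<eta> m = 3 * \<eta> 0"
  "eval L found_cell \<eta> m = 3 * \<eta> 0 + 1"
  by (simp_all add: indep_entry_def reach_entry_def bound_cell_def found_cell_def)

text \<open>Horner's rule from the last cell downwards, because the most significant digit comes
  last. Once the address is no longer beyond the sign, the value is kept.\<close>

definition read_bound :: com where
  "read_bound = For 5 (Write bound_cell
     (let a = Minus (Minus (Var 0) (Num 1)) (Var 5)
      in Cond (Less sign_address a)
           (Plus (Plus (Fetch bound_cell) (Fetch bound_cell)) (Fetch a)) (Fetch bound_cell)))"

text \<open>
  The variables from \<open>10\<close> on are the witness: \<open>s\<close> variables each for the ends \<open>w\<close> and \<open>j\<close> of
  the edges of the induced matching, then \<open>2 s\<close> variables for the connecting vertices.
\<close>

definition compute_indep :: "nat \<Rightarrow> com" where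
  "compute_indep s = For 5 (Write (indep_entry 5) (And (vert 5)
     (Or (Any (map (\<lambda>i. Equal (Var 5) (Var (10 + s + i))) [0..<s]))
       (And
         (Forall 6 (Neg (And (Less (Var 6) (Var 5)) (And (Fetch (indep_entry 6)) (edge 5 6)))))
         (Every (map (\<lambda>i. Or (Neg (Less (Var 5) (Var (10 + s + i))))
            (Neg (Or (Equal (Var 5) (Var (10 + i))) (Or (edge 5 (10 + i)) (edge 5 (10 + s + i))))))
            [0..<s]))))))"

definition in_cover :: "nat \<Rightarrow> nat \<Rightarrow> exp" where
  "in_cover s x = And (vert x) (Or (Neg (Fetch (indep_entry x)))
     (Any (map (\<lambda>i. Equal (Var x) (Var (10 + 2 * s + i))) [0..<2 * s])))"

definition init_reach :: "nat \<Rightarrow> com" where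
  "init_reach s = For 5 (Write (reach_entry 5)
     (And (in_cover s 5) (Neg (Exists 6 (And (Less (Var 6) (Var 5)) (in_cover s 6))))))"

definition expand_reach :: "nat \<Rightarrow> com" where
  "expand_reach s = For 5 (Write (reach_entry 5)
     (Or (Fetch (reach_entry 5)) (And (in_cover s 5)
       (Exists 6 (And (in_cover s 6) (And (Fetch (reach_entry 6)) (edge 6 5)))))))"

definition cover_test :: "nat \<Rightarrow> exp" where
  "cover_test s =
     And (Exists 5 (in_cover s 5))
    (And (Forall 5 (Or (Neg (in_cover s 5)) (Fetch (reach_entry 5))))
    (And (Forall 5 (Forall 6 (Or (Neg (edge 5 6)) (Or (in_cover s 5) (in_cover s 6)))))
         (Neg (Less (Fetch bound_cell) (Sum 5 (Cond (in_cover s 5) (Num 1) (Num 0)))))))"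

text \<open>Each run rewrites all entries of both work areas, so nothing is left over from the
  previous witness; the result cell stays nonzero once it is.\<close>

definition test_witness :: "nat \<Rightarrow> com" where
  "test_witness s =
     Seq (compute_indep s) (Seq (init_reach s) (Seq (For 7 (expand_reach s))
       (Write found_cell (Or (Fetch found_cell) (cover_test s)))))"

primrec nested_loops :: "nat \<Rightarrow> com \<Rightarrow> com" where
  "nested_loops 0 c = c"
| "nested_loops (Suc d) c = For (10 + d) (nested_loops d c)"

definition cvc_program :: "nat \<Rightarrow> com" where
  "cvc_program s = Seq read_bound (nested_loops (4 * s) (test_witness s))"

text \<open>The search compares with the absolute value of \<open>k\<close>; a negative
  \<open>k\<close> is rejected by its sign.\<close>

definition cvc_answer :: exp where
  "cvc_answer = And (Neg (Fetch sign_address)) (Fetch found_cell)"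

text \<open>The body relies on \<open>ok\<close> and restores it, and \<open>flag\<close>
  accumulates the verdicts. As \<open>good\<close> depends on the environment alone, the verdict on
  a tuple does not depend on the tuples tried before. The function \<open>f\<close> collects the
  values of the loop variables.\<close>

lemma run_nested_loops:
  assumes body: "\<And>\<eta> m. \<eta> 0 = L \<Longrightarrow> ok m \<Longrightarrow>
      ok (run L c \<eta> m) \<and> (flag (run L c \<eta> m) \<longleftrightarrow> flag m \<or> good \<eta>)"
    and "\<eta> 0 = L" "ok m"
  shows "ok (run L (nested_loops d c) \<eta> m) \<and> (flag (run L (nested_loops d c) \<eta> m) \<longleftrightarrow> flag m \<or>
    (\<exists>f. (\<forall>i<d. f i < L) \<and> good (\<lambda>x. if 10 \<le> x \<and> x < 10 + d then f (x - 10) else \<eta> x)))"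
  using assms(2,3)
proof (induction d arbitrary: \<eta> m)
  case 0
  have "(\<lambda>x. if 10 \<le> x \<and> x < 10 then f (x - 10) else \<eta> x) = \<eta>" for f :: "nat \<Rightarrow> nat"
    by (rule ext) auto
  then show ?case using body[of \<eta> m, OF 0] by simp
next
  case (Suc d)
  let ?G = "\<lambda>d \<eta>. \<exists>f. (\<forall>i<d. f i < L) \<and> good (\<lambda>x. if 10 \<le> x \<and> x < 10 + d then f (x - 10) else \<eta> x)"
  define Q where "Q j \<longleftrightarrow> ?G d (\<eta>(10 + d := j))" for j
  have "ok (run L (nested_loops (Suc d) c) \<eta> m) \<and>
    (flag (run L (nested_loops (Suc d) c) \<eta> m) \<longleftrightarrow> flag m \<or> (\<exists>j<L. Q j))"
    unfolding nested_loops.simps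
  proof (rule run_For_invariant[where P = "\<lambda>i m'. ok m' \<and> (flag m' \<longleftrightarrow> flag m \<or> (\<exists>j<i. Q j))"])
    fix i m'
    assume m': "ok m' \<and> (flag m' \<longleftrightarrow> flag m \<or> (\<exists>j<i. Q j))"
    have "(\<eta>(10 + d := i)) 0 = L" using Suc.prems by simp
    from Suc.IH[of "\<eta>(10 + d := i)" m', OF this conjunct1[OF m']]
    have "ok (run L (nested_loops d c) (\<eta>(10 + d := i)) m')"
      "flag (run L (nested_loops d c) (\<eta>(10 + d := i)) m') \<longleftrightarrow> flag m' \<or> Q i"
      unfolding Q_def by (rule conjunct1, elim conjunct2)
    then show "ok (run L (nested_loops d c) (\<eta>(10 + d := i)) m') \<and>
      (flag (run L (nested_loops d c) (\<eta>(10 + d := i)) m') \<longleftrightarrow> flag m \<or> (\<exists>j<Suc i. Q j))"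
      using m' by (auto simp: less_Suc_eq)
  qed (use Suc.prems in simp)
  moreover have "(\<exists>k<L. ?G d (\<eta>(10 + d := k))) \<longleftrightarrow> ?G (Suc d) \<eta>"
  proof
    assume "\<exists>k<L. ?G d (\<eta>(10 + d := k))"
    then obtain k f where k: "k < L" "\<forall>i<d. f i < L"
      "good (\<lambda>x. if 10 \<le> x \<and> x < 10 + d then f (x - 10) else (\<eta>(10 + d := k)) x)" by blast
    have "(\<lambda>x. if 10 \<le> x \<and> x < 10 + d then f (x - 10) else (\<eta>(10 + d := k)) x) =
       (\<lambda>x. if 10 \<le> x \<and> x < 10 + Suc d then (f(d := k)) (x - 10) else \<eta> x)"
      by (rule ext) auto
    then show "?G (Suc d) \<eta>" using k by (intro exI[of _ "f(d := k)"]) (auto simp: less_Suc_eq)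
  next
    assume "?G (Suc d) \<eta>"
    then obtain f where f: "\<forall>i<Suc d. f i < L"
      "good (\<lambda>x. if 10 \<le> x \<and> x < 10 + Suc d then f (x - 10) else \<eta> x)" by blast
    have "(\<lambda>x. if 10 \<le> x \<and> x < 10 + Suc d then f (x - 10) else \<eta> x) =
       (\<lambda>x. if 10 \<le> x \<and> x < 10 + d then f (x - 10) else (\<eta>(10 + d := f d)) x)"
      by (rule ext) (auto simp: less_Suc_eq)
    then have "?G d (\<eta>(10 + d := f d))" using f by (intro exI[of _ f]) auto
    then show "\<exists>k<L. ?G d (\<eta>(10 + d := k))" using f(1) by blast
  qed
  ultimately show ?case unfolding Q_def by simp
qed

lemma nth_concat_uniform:
  assumes "\<And>ys. ys \<in> set yss \<Longrightarrow> length ys = n" "u < length yss" "v < n"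
  shows "concat yss ! (u * n + v) = yss ! u ! v"
  using assms
proof (induction yss arbitrary: u)
  case (Cons ys yss)
  then show ?case by (cases u) (auto simp: nth_append add.assoc)
qed simp

definition bits_value :: "bool list \<Rightarrow> nat" where
  "bits_value bs = foldr (\<lambda>b a. of_bool b + 2 * a) bs 0"

lemma bits_value_nat_bits: "bits_value (nat_bits q) = q"
proof (induction q rule: less_induct)
  case (less q)
  show ?case
  proof (cases "q = 0")
    case True
    then show ?thesis by (simp add: nat_bits.simps bits_value_def)
  next
    case False
    then have "bits_value (nat_bits (q div 2)) = q div 2" by (intro less) auto
    moreover have "nat_bits q = odd q # nat_bits (q div 2)" using False by (subst nat_bits.simps) simp
    ultimately have "bits_value (nat_bits q) = of_bool (odd q) + 2 * (q div 2)"
      by (simp add: bits_value_def)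
    then show ?thesis by (cases "odd q") auto
  qed
qed

section \<open>Correctness\<close>

locale cvc_input =
  fixes G :: "nat pair_pre_digraph" and k :: int and n :: nat
  assumes G: "pair_graph G" and n: "pverts G = {..<n}"
begin

definition E :: "nat \<Rightarrow> nat \<Rightarrow> bool" where
  "E u v \<longleftrightarrow> (u, v) \<in> parcs G"

definition digits :: "bool list" where
  "digits = nat_bits (nat \<bar>k\<bar>)"

definition L :: nat where
  "L = length (cvc_encoding (G, k))"

text \<open>This mentions only cells below \<open>L\<close>, whereas the program writes only at
  \<open>L\<close> and above, so by \<open>input_cong\<close> it survives every write.\<close>

definition input :: "(nat \<Rightarrow> nat) \<Rightarrow> bool" where
  "input m \<longleftrightarrow> (\<forall>a<n. m a = 1) \<and> m n = 0 \<and>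
     (\<forall>u<n. \<forall>v<n. m (n + 1 + u * n + v) = of_bool (E u v)) \<and>
     m (n + 1 + n * n) = of_bool (k < 0) \<and>
     (\<forall>i<length digits. m (n + 1 + n * n + 1 + i) = of_bool (digits ! i))"

lemma encoding:
  "cvc_encoding (G, k) = replicate n True @ [False] @
     concat (map (\<lambda>u. map (\<lambda>v. E u v) [0..<n]) [0..<n]) @ [k < 0] @ digits"
  using n by (simp add: cvc_encoding_def graph_bits_def int_bits_def E_def digits_def Let_def)

lemma length_matrix: "length (concat (map (\<lambda>u. map (\<lambda>v. E u v) [0..<n]) [0..<n])) = n * n"
  by (simp add: length_concat comp_def sum_list_triv)

lemma L_eq: "L = n + 1 + n * n + 1 + length digits"
  unfolding L_def encoding length_append length_matrix by simp

lemma L_bounds: "n < L" "n * n < L" "0 < L"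
  by (simp_all add: L_eq)

lemma input_init: "input (mem (init (cvc_encoding (G, k))))"
proof -
  let ?x = "cvc_encoding (G, k)"
  let ?M = "concat (map (\<lambda>u. map (\<lambda>v. E u v) [0..<n]) [0..<n])"
  have m: "mem (init ?x) a = of_bool (?x ! a)" if "a < L" for a
    using that by (simp add: init_def L_def)
  have 1: "?x ! a" if "a < n" for a using that unfolding encoding by (simp add: nth_append)
  have 2: "\<not> ?x ! n" unfolding encoding by (simp add: nth_append)
  have uv: "u * n + v < n * n" if "u < n" "v < n" for u v
  proof -
    have "u * n + v < Suc u * n" using that by simp
    also have "\<dots> \<le> n * n" using that by (intro mult_le_mono1) simp
    finally show ?thesis .
  qed
  have 3: "?x ! (n + 1 + u * n + v) = E u v" if "u < n" "v < n" for u v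
  proof -
    have "?x ! (n + 1 + u * n + v) = ?M ! (u * n + v)"
      unfolding encoding using uv[OF that] length_matrix by (simp add: nth_append)
    also have "\<dots> = map (\<lambda>u. map (\<lambda>v. E u v) [0..<n]) [0..<n] ! u ! v"
      by (rule nth_concat_uniform) (use that in auto)
    finally show ?thesis using that by simp
  qed
  have split: "?x = (replicate n True @ [False] @ ?M) @ ((k < 0) # digits)"
    unfolding encoding by simp
  have len: "length (replicate n True @ [False] @ ?M) = n + 1 + n * n"
    unfolding length_append length_matrix by simp
  have 4: "?x ! (n + 1 + n * n) = (k < 0)"
    unfolding split by (metis len nth_append_length)
  have 5: "?x ! (n + 1 + n * n + 1 + i) = digits ! i" for i
  proof -
    have "?x ! (n + 1 + n * n + Suc i) = ((k < 0) # digits) ! Suc i"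
      unfolding split by (metis len nth_append_length_plus)
    then show ?thesis by simp
  qed
  show ?thesis
    unfolding input_def
  proof (intro conjI allI impI)
    show "mem (init ?x) a = 1" if "a < n" for a using m[of a] 1[OF that] that L_bounds by simp
    show "mem (init ?x) n = 0" using m[of n] 2 L_bounds by simp
    show "mem (init ?x) (n + 1 + u * n + v) = of_bool (E u v)" if "u < n" "v < n" for u v
      using m[of "n + 1 + u * n + v"] 3[OF that] uv[OF that] by (simp add: L_eq)
    show "mem (init ?x) (n + 1 + n * n) = of_bool (k < 0)" using m[of "n + 1 + n * n"] 4 by (simp add: L_eq)
    show "mem (init ?x) (n + 1 + n * n + 1 + i) = of_bool (digits ! i)" if "i < length digits" for i
      using m[of "n + 1 + n * n + 1 + i"] 5[of i] that by (simp add: L_eq)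
  qed
qed

lemma input_cong:
  assumes "input m" "\<And>a. a < L \<Longrightarrow> m' a = m a"
  shows "input m'"
proof -
  have uv: "n + 1 + u * n + v < L" if "u < n" "v < n" for u v
  proof -
    have "u * n + v < Suc u * n" using that by simp
    also have "\<dots> \<le> n * n" using that by (intro mult_le_mono1) simp
    finally show ?thesis by (simp add: L_eq)
  qed
  have "m' a = m a" if "a < n" for a using that assms(2) L_bounds(1) by simp
  moreover have "m' n = m n" using assms(2) L_bounds(1) by simp
  moreover have "m' (n + 1 + u * n + v) = m (n + 1 + u * n + v)" if "u < n" "v < n" for u v
    using assms(2) uv[OF that] by simp
  moreover have "m' (n + 1 + n * n) = m (n + 1 + n * n)" using assms(2) by (simp add: L_eq)
  moreover have "m' (n + 1 + n * n + 1 + i) = m (n + 1 + n * n + 1 + i)" if "i < length digits" for i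
    using assms(2) that by (simp add: L_eq)
  ultimately show ?thesis using assms(1) unfolding input_def by simp
qed

text \<open>The sum counts the \<open>i\<close> for which the cells 0 to \<open>i\<close> are all
  nonzero. These are the positions of the unary prefix: the zero in cell \<open>n\<close> stops the
  count whatever the matrix contains.\<close>

lemma eval_num_verts:
  assumes "input m"
  shows "eval L num_verts \<eta> m = n"
proof -
  have "(\<forall>j<L. i < j \<or> m j \<noteq> 0) \<longleftrightarrow> i < n" if "i < L" for i
  proof
    assume "\<forall>j<L. i < j \<or> m j \<noteq> 0"
    then have "i < n \<or> m n \<noteq> 0" using L_bounds by blast
    then show "i < n" using assms by (simp add: input_def)
  next
    assume i: "i < n"
    have "m j \<noteq> 0" if "\<not> i < j" for j using i that assms by (simp add: input_def)
    then show "\<forall>j<L. i < j \<or> m j \<noteq> 0" by blast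
  qed
  then have "eval L num_verts \<eta> m = (\<Sum>i<L. of_bool (i < n))"
    by (auto simp: num_verts_def eval_Forall intro!: sum.cong)
  also have "\<dots> = card ({..<L} \<inter> {i. i < n})" by simp
  also have "{..<L} \<inter> {i. i < n} = {..<n}" using L_bounds by auto
  finally show ?thesis by simp
qed

lemma eval_times_num_verts:
  assumes "input m" "\<And>j. eval L e (\<eta>(3 := j)) m = u" "u \<le> L"
  shows "eval L (times_num_verts e) \<eta> m = u * n"
proof -
  have "eval L (times_num_verts e) \<eta> m = (\<Sum>i<L. if i < u then n else 0)"
    using assms by (simp add: times_num_verts_def eval_num_verts Less_def not_le cong: if_cong)
  also have "\<dots> = card ({..<L} \<inter> {i. i < u}) * n"
    by (simp add: sum.If_cases)
  also have "{..<L} \<inter> {i. i < u} = {..<u}" using assms(3) by auto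
  finally show ?thesis by simp
qed

lemma eval_sign_address:
  assumes "input m"
  shows "eval L sign_address \<eta> m = n + 1 + n * n"
  using eval_times_num_verts[of m num_verts \<eta> n] eval_num_verts[OF assms] assms L_bounds
  by (simp add: sign_address_def)

lemma holds_vert:
  assumes "input m"
  shows "holds L (vert x) \<eta> m \<longleftrightarrow> \<eta> x < n"
  using eval_num_verts[OF assms] by (simp add: vert_def)

lemma E_bounds: "E u v \<Longrightarrow> u < n" "E u v \<Longrightarrow> v < n"
proof -
  interpret pair_graph G by (rule G)
  show "E u v \<Longrightarrow> u < n" "E u v \<Longrightarrow> v < n"
    using in_arcsD1[of u v] in_arcsD2[of u v] n by (auto simp: E_def)
qed

lemma symp_E: "symp E"
proof -
  interpret pair_graph G by (rule G)
  show ?thesis using pair_sym_arcs by (auto simp: symmetric_def E_def symp_def dest: symD)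
qed

lemma holds_edge:
  assumes "input m" "x \<noteq> 3"
  shows "holds L (edge x y) \<eta> m \<longleftrightarrow> E (\<eta> x) (\<eta> y)"
proof (cases "\<eta> x < n \<and> \<eta> y < n")
  case True
  then have "eval L (times_num_verts (Var x)) \<eta> m = \<eta> x * n"
    using assms L_bounds by (intro eval_times_num_verts) auto
  moreover have "m (n + 1 + \<eta> x * n + \<eta> y) = of_bool (E (\<eta> x) (\<eta> y))"
    using True assms(1) unfolding input_def by blast
  ultimately show ?thesis
    using True assms by (simp add: edge_def holds_vert eval_num_verts)
next
  case False
  then show ?thesis using assms E_bounds by (auto simp: edge_def holds_vert)
qed

lemma run_read_bound:
  assumes "\<eta> 0 = L" "input m" "m (3 * L) = 0"
  shows "(\<forall>a. a \<noteq> 3 * L \<longrightarrow> run L read_bound \<eta> m a = m a) \<and>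
    run L read_bound \<eta> m (3 * L) = nat \<bar>k\<bar>"
proof -
  \<comment> \<open>After \<open>i\<close> rounds the last \<open>i\<close> digits have been read;
    truncated subtraction turns this into all digits once the rounds outnumber them.\<close>
  let ?P = "\<lambda>i m'. (\<forall>a. a \<noteq> 3 * L \<longrightarrow> m' a = m a) \<and>
     m' (3 * L) = bits_value (drop (length digits - i) digits)"
  have "?P L (run L read_bound \<eta> m)"
    unfolding read_bound_def
  proof (rule run_For_invariant[where P = ?P])
    show "?P 0 m" using assms by (simp add: bits_value_def)
    fix i m' assume i: "i < L" and P: "?P i m'"
    have "input m'" using P L_bounds by (intro input_cong[OF assms(2)]) auto
    then have sa: "eval L sign_address \<eta>' m' = n + 1 + n * n" for \<eta>' by (rule eval_sign_address)
    let ?a = "L - 1 - i"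
    let ?v = "if n + 1 + n * n < ?a then 2 * m' (3 * L) + m' ?a else m' (3 * L)"
    have "?v = bits_value (drop (length digits - Suc i) digits)"
    proof (cases "i < length digits")
      case True
      define q where "q = length digits - Suc i"
      have q: "q < length digits" "length digits - i = Suc q" "?a = n + 1 + n * n + 1 + q"
        using True by (auto simp: q_def L_eq)
      have "m' ?a = of_bool (digits ! q)"
        using \<open>input m'\<close> q(1) unfolding q(3) input_def by blast
      moreover have "drop q digits = digits ! q # drop (Suc q) digits"
        using q(1) by (simp add: Cons_nth_drop_Suc)
      ultimately show ?thesis
        using P q unfolding q_def[symmetric] by (simp add: bits_value_def)
    next
      case False
      then have "\<not> n + 1 + n * n < ?a" by (simp add: L_eq)
      then show ?thesis using P False by simp
    qed
    moreover have "eval L (let a = Minus (Minus (Var 0) (Num 1)) (Var 5)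
      in Cond (Less sign_address a)
           (Plus (Plus (Fetch bound_cell) (Fetch bound_cell)) (Fetch a)) (Fetch bound_cell))
        (\<eta>(5 := i)) m' = ?v"
      using sa assms(1) by (auto simp add: Less_def mult_2 Let_def)
    ultimately show "?P (Suc i) (run L (Write bound_cell
     (let a = Minus (Minus (Var 0) (Num 1)) (Var 5)
      in Cond (Less sign_address a)
           (Plus (Plus (Fetch bound_cell) (Fetch bound_cell)) (Fetch a)) (Fetch bound_cell)))
        (\<eta>(5 := i)) m')"
      using P assms(1) by simp
  qed
  then show ?thesis using bits_value_nat_bits by (simp add: L_eq digits_def)
qed

section \<open>Correctness of the test of a single tuple\<close>

definition cover :: "nat \<Rightarrow> (nat \<Rightarrow> nat) \<Rightarrow> (nat \<Rightarrow> nat) \<Rightarrow> nat set" where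
  "cover s \<eta> m = {v. v < n \<and> (m (L + v) = 0 \<or> (\<exists>i<2*s. v = \<eta> (10 + 2 * s + i)))}"

lemma cover_upd [simp]: "x < 10 \<Longrightarrow> cover s (\<eta>(x := j)) m = cover s \<eta> m"
  by (auto simp: cover_def)

lemma cover_cong: "(\<And>v. v < n \<Longrightarrow> m' (L + v) = m (L + v)) \<Longrightarrow> cover s \<eta> m' = cover s \<eta> m"
  by (auto simp: cover_def)

lemma cover_bound: "v \<in> cover s \<eta> m \<Longrightarrow> v < n"
  by (simp add: cover_def)

lemma holds_in_cover:
  assumes "input m" "\<eta> 0 = L"
  shows "holds L (in_cover s x) \<eta> m \<longleftrightarrow> \<eta> x \<in> cover s \<eta> m"
  using assms by (auto simp: in_cover_def cover_def holds_vert)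

text \<open>Entries are written in increasing order and each consults only smaller ones, which are
  final by then; so the result solves the recursion in \<open>greedy_set\<close>.\<close>

lemma run_compute_indep:
  fixes s :: nat
  assumes \<eta>: "\<eta> 0 = L" and input: "input m"
  defines "m' \<equiv> run L (compute_indep s) \<eta> m"
  shows "\<forall>a. a < L \<or> 2 * L \<le> a \<longrightarrow> m' a = m a"
    and "greedy_set E s (\<lambda>i. \<eta> (10 + i)) (\<lambda>i. \<eta> (10 + s + i)) {..<n} {v. v < n \<and> m' (L + v) \<noteq> 0}"
proof -
  let ?w = "\<lambda>i. \<eta> (10 + i)" and ?j = "\<lambda>i. \<eta> (10 + s + i)"
  let ?C = "\<lambda>m v. (\<exists>i<s. v = ?j i) \<or> ((\<forall>u<v. m (L + u) \<noteq> 0 \<longrightarrow> \<not> E v u) \<and>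
    (\<forall>i<s. v < ?j i \<longrightarrow> v \<noteq> ?w i \<and> \<not> E v (?w i) \<and> \<not> E v (?j i)))"
  let ?P = "\<lambda>i m'. (\<forall>a. a < L \<or> 2 * L \<le> a \<longrightarrow> m' a = m a) \<and>
     (\<forall>v<i. m' (L + v) \<noteq> 0 \<longleftrightarrow> v < n \<and> ?C m' v)"
  have "?P L m'"
    unfolding m'_def compute_indep_def
  proof (rule run_For_invariant[where P = ?P])
    show "?P 0 m" by simp
    fix i m' assume i: "i < L" and P: "?P i m'"
    let ?e = "And (vert 5)
     (Or (Any (map (\<lambda>i. Equal (Var 5) (Var (10 + s + i))) [0..<s]))
       (And
         (Forall 6 (Neg (And (Less (Var 6) (Var 5)) (And (Fetch (indep_entry 6)) (edge 5 6)))))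
         (Every (map (\<lambda>i. Or (Neg (Less (Var 5) (Var (10 + s + i))))
            (Neg (Or (Equal (Var 5) (Var (10 + i))) (Or (edge 5 (10 + i)) (edge 5 (10 + s + i))))))
            [0..<s]))))"
    have inp: "input m'" using P by (intro input_cong[OF input]) auto
    have "holds L ?e (\<eta>(5 := i)) m' \<longleftrightarrow> i < n \<and> ?C m' i"
    proof -
      have "holds L (Forall 6 (Neg (And (Less (Var 6) (Var 5)) (And (Fetch (indep_entry 6)) (edge 5 6)))))
          (\<eta>(5 := i)) m' \<longleftrightarrow> (\<forall>u<i. m' (L + u) \<noteq> 0 \<longrightarrow> \<not> E i u)"
      proof -
        have "u < L" if "u < i" for u using that i by simp
        then have "(\<forall>u<L. \<not> (u < i \<and> m' (L + u) \<noteq> 0 \<and> E i u)) \<longleftrightarrow>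
            (\<forall>u<i. m' (L + u) \<noteq> 0 \<longrightarrow> \<not> E i u)" by blast
        then show ?thesis using \<eta> by (simp add: holds_edge[OF inp])
      qed
      moreover have "holds L (Every (map (\<lambda>i. Or (Neg (Less (Var 5) (Var (10 + s + i))))
            (Neg (Or (Equal (Var 5) (Var (10 + i))) (Or (edge 5 (10 + i)) (edge 5 (10 + s + i))))))
            [0..<s])) (\<eta>(5 := i)) m' \<longleftrightarrow>
          (\<forall>i'<s. i < ?j i' \<longrightarrow> i \<noteq> ?w i' \<and> \<not> E i (?w i') \<and> \<not> E i (?j i'))"
        by (auto simp: holds_edge[OF inp])
      moreover have "holds L (Any (map (\<lambda>i. Equal (Var 5) (Var (10 + s + i))) [0..<s])) (\<eta>(5 := i)) m'
          \<longleftrightarrow> (\<exists>i'<s. i = ?j i')"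
        by auto
      moreover have "holds L (vert 5) (\<eta>(5 := i)) m' \<longleftrightarrow> i < n"
        by (simp add: holds_vert[OF inp])
      ultimately show ?thesis unfolding holds_simps(3,4) by simp
    qed
    then have e: "eval L ?e (\<eta>(5 := i)) m' \<noteq> 0 \<longleftrightarrow> i < n \<and> ?C m' i"
      unfolding holds_def .
    let ?m = "m'(L + i := eval L ?e (\<eta>(5 := i)) m')"
    have run: "run L (Write (indep_entry 5) ?e) (\<eta>(5 := i)) m' = ?m"
      using \<eta> by simp
    \<comment> \<open>Writing entry \<open>i\<close> does not disturb the conditions for
      \<open>v \<le> i\<close>, which look strictly below \<open>v\<close>.\<close>
    have C: "?C ?m v \<longleftrightarrow> ?C m' v" if "v \<le> i" for v using that by auto
    show "?P (Suc i) (run L (Write (indep_entry 5) ?e) (\<eta>(5 := i)) m')"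
      unfolding run
    proof (intro conjI allI impI)
      fix v assume "v < Suc i"
      show "?m (L + v) \<noteq> 0 \<longleftrightarrow> v < n \<and> ?C ?m v"
      proof (cases "v = i")
        case True
        then show ?thesis using C[of i] e by (simp only: fun_upd_same)
      next
        case False
        then have "v < i" using \<open>v < Suc i\<close> by simp
        then have "m' (L + v) \<noteq> 0 \<longleftrightarrow> v < n \<and> ?C m' v" using P by blast
        moreover have "?m (L + v) = m' (L + v)" using \<open>v < i\<close> by simp
        ultimately show ?thesis using C[of v] \<open>v < i\<close> by (simp only: less_imp_le)
      qed
    qed (use P i in auto)
  qed
  then show "\<forall>a. a < L \<or> 2 * L \<le> a \<longrightarrow> m' a = m a" by blast
  have entry: "m' (L + v) \<noteq> 0 \<longleftrightarrow> ?C m' v" if "v < n" for v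
    using \<open>?P L m'\<close> that L_bounds(1) by simp
  have C: "?C m' v \<longleftrightarrow> (\<exists>i<s. v = ?j i) \<or> ((\<forall>u\<in>{v. v < n \<and> m' (L + v) \<noteq> 0}. u < v \<longrightarrow> \<not> E v u) \<and>
    (\<forall>i<s. v < ?j i \<longrightarrow> v \<noteq> ?w i \<and> \<not> E v (?w i) \<and> \<not> E v (?j i)))" if "v < n" for v
    using that by auto
  show "greedy_set E s ?w ?j {..<n} {v. v < n \<and> m' (L + v) \<noteq> 0}"
    unfolding greedy_set_def
  proof (intro conjI ballI)
    fix v assume "v \<in> {..<n}"
    then have v: "v < n" by simp
    then have "v \<in> {v. v < n \<and> m' (L + v) \<noteq> 0} \<longleftrightarrow> m' (L + v) \<noteq> 0" by simp
    also note entry[OF v]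
    also note C[OF v]
    finally show "v \<in> {v. v < n \<and> m' (L + v) \<noteq> 0} \<longleftrightarrow> (\<exists>i<s. v = ?j i) \<or>
      ((\<forall>u\<in>{v. v < n \<and> m' (L + v) \<noteq> 0}. u < v \<longrightarrow> \<not> E v u) \<and>
       (\<forall>i<s. v < ?j i \<longrightarrow> v \<noteq> ?w i \<and> \<not> E v (?w i) \<and> \<not> E v (?j i)))" .
  qed auto
qed

lemma run_init_reach:
  fixes s :: nat
  assumes \<eta>: "\<eta> 0 = L" and input: "input m"
  defines "m' \<equiv> run L (init_reach s) \<eta> m"
  shows "\<forall>a. a < 2 * L \<or> 3 * L \<le> a \<longrightarrow> m' a = m a"
    and "\<forall>v<L. m' (2 * L + v) \<noteq> 0 \<longleftrightarrow> v \<in> cover s \<eta> m \<and> (\<forall>u<v. u \<notin> cover s \<eta> m)"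
proof -
  let ?S = "cover s \<eta> m"
  let ?P = "\<lambda>i m'. (\<forall>a. a < 2 * L \<or> 3 * L \<le> a \<longrightarrow> m' a = m a) \<and>
     (\<forall>v<i. m' (2 * L + v) \<noteq> 0 \<longleftrightarrow> v \<in> ?S \<and> (\<forall>u<v. u \<notin> ?S))"
  have "?P L m'"
    unfolding m'_def init_reach_def
  proof (rule run_For_invariant[where P = ?P])
    show "?P 0 m" by simp
    fix i m' assume i: "i < L" and P: "?P i m'"
    let ?e = "And (in_cover s 5) (Neg (Exists 6 (And (Less (Var 6) (Var 5)) (in_cover s 6))))"
    have inp: "input m'" using P by (intro input_cong[OF input]) auto
    have S: "cover s \<eta> m' = ?S" using P L_bounds by (intro cover_cong) auto
    have "holds L ?e (\<eta>(5 := i)) m' \<longleftrightarrow> i \<in> ?S \<and> (\<forall>u<i. u \<notin> ?S)"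
      using i \<eta> by (auto simp: holds_in_cover[OF inp] S)
    then have e: "eval L ?e (\<eta>(5 := i)) m' \<noteq> 0 \<longleftrightarrow> i \<in> ?S \<and> (\<forall>u<i. u \<notin> ?S)"
      unfolding holds_def .
    have run: "run L (Write (reach_entry 5) ?e) (\<eta>(5 := i)) m' =
        m'(2 * L + i := eval L ?e (\<eta>(5 := i)) m')"
      using \<eta> by simp
    show "?P (Suc i) (run L (Write (reach_entry 5) ?e) (\<eta>(5 := i)) m')"
      unfolding run using P i e by (simp add: less_Suc_eq del: eval.simps)
  qed
  then show "\<forall>a. a < 2 * L \<or> 3 * L \<le> a \<longrightarrow> m' a = m a"
    and "\<forall>v<L. m' (2 * L + v) \<noteq> 0 \<longleftrightarrow> v \<in> ?S \<and> (\<forall>u<v. u \<notin> ?S)" by blast+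
qed

text \<open>Marks are updated in place, so one round may propagate by more than one step. Its effect
  is therefore bracketed: neighbours in the cover of previously marked cover vertices become marked,
  and no mark leaves a set \<open>C\<close> that contains the old marks and is closed under the
  edges inside the cover.\<close>

lemma run_expand_reach:
  fixes s :: nat
  assumes \<eta>: "\<eta> 0 = L" and input: "input m"
    and C: "\<forall>v<L. m (2 * L + v) \<noteq> 0 \<longrightarrow> v \<in> C"
      "\<forall>u \<in> C \<inter> cover s \<eta> m. \<forall>v \<in> cover s \<eta> m. E u v \<longrightarrow> v \<in> C"
  defines "m' \<equiv> run L (expand_reach s) \<eta> m"
  shows "\<forall>a. a < 2 * L \<or> 3 * L \<le> a \<longrightarrow> m' a = m a"
    and "\<forall>v<L. m (2 * L + v) \<noteq> 0 \<longrightarrow> m' (2 * L + v) \<noteq> 0"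
    and "\<forall>v<L. v \<in> cover s \<eta> m \<longrightarrow> (\<exists>u \<in> cover s \<eta> m. m (2 * L + u) \<noteq> 0 \<and> E u v) \<longrightarrow> m' (2 * L + v) \<noteq> 0"
    and "\<forall>v<L. m' (2 * L + v) \<noteq> 0 \<longrightarrow> v \<in> C"
proof -
  let ?S = "cover s \<eta> m"
  let ?P = "\<lambda>i m'. (\<forall>a. a < 2 * L \<or> 3 * L \<le> a \<longrightarrow> m' a = m a) \<and>
     (\<forall>v<L. m (2 * L + v) \<noteq> 0 \<longrightarrow> m' (2 * L + v) \<noteq> 0) \<and>
     (\<forall>v<i. v \<in> ?S \<longrightarrow> (\<exists>u \<in> ?S. m (2 * L + u) \<noteq> 0 \<and> E u v) \<longrightarrow> m' (2 * L + v) \<noteq> 0) \<and>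
     (\<forall>v<L. m' (2 * L + v) \<noteq> 0 \<longrightarrow> v \<in> C)"
  have "?P L m'"
    unfolding m'_def expand_reach_def
  proof (rule run_For_invariant[where P = ?P])
    show "?P 0 m" using C(1) by simp
    fix i m' assume i: "i < L" and P: "?P i m'"
    let ?e = "Or (Fetch (reach_entry 5)) (And (in_cover s 5)
       (Exists 6 (And (in_cover s 6) (And (Fetch (reach_entry 6)) (edge 6 5)))))"
    have inp: "input m'" using P by (intro input_cong[OF input]) auto
    have S: "cover s \<eta> m' = ?S" using P L_bounds by (intro cover_cong) auto
    have SL: "u < L" if "u \<in> ?S" for u using cover_bound[OF that] L_bounds by simp
    have "holds L ?e (\<eta>(5 := i)) m' \<longleftrightarrow>
        m' (2 * L + i) \<noteq> 0 \<or> i \<in> ?S \<and> (\<exists>u\<in>?S. m' (2 * L + u) \<noteq> 0 \<and> E u i)"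
      using SL \<eta> by (auto simp: holds_in_cover[OF inp] holds_edge[OF inp] S)
    then have e: "eval L ?e (\<eta>(5 := i)) m' \<noteq> 0 \<longleftrightarrow>
        m' (2 * L + i) \<noteq> 0 \<or> i \<in> ?S \<and> (\<exists>u\<in>?S. m' (2 * L + u) \<noteq> 0 \<and> E u i)"
      unfolding holds_def .
    define x where "x = eval L ?e (\<eta>(5 := i)) m'"
    have run: "run L (Write (reach_entry 5) ?e) (\<eta>(5 := i)) m' = m'(2 * L + i := x)"
      using \<eta> by (simp add: x_def)
    have "x \<noteq> 0 \<longrightarrow> i \<in> C"
      using e P i C(2) SL unfolding x_def[symmetric] by blast
    moreover have "x \<noteq> 0" if "i \<in> ?S" "\<exists>u\<in>?S. m (2 * L + u) \<noteq> 0 \<and> E u i"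
      using e P SL that unfolding x_def[symmetric] by blast
    moreover have "x \<noteq> 0" if "m' (2 * L + i) \<noteq> 0"
      using e that unfolding x_def[symmetric] by blast
    ultimately show "?P (Suc i) (run L (Write (reach_entry 5) ?e) (\<eta>(5 := i)) m')"
      unfolding run using P i by (auto simp: less_Suc_eq)
  qed
  then show "\<forall>a. a < 2 * L \<or> 3 * L \<le> a \<longrightarrow> m' a = m a"
    and "\<forall>v<L. m (2 * L + v) \<noteq> 0 \<longrightarrow> m' (2 * L + v) \<noteq> 0"
    and "\<forall>v<L. v \<in> ?S \<longrightarrow> (\<exists>u \<in> ?S. m (2 * L + u) \<noteq> 0 \<and> E u v) \<longrightarrow> m' (2 * L + v) \<noteq> 0"
    and "\<forall>v<L. m' (2 * L + v) \<noteq> 0 \<longrightarrow> v \<in> C"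
    by blast+
qed

lemma run_reach:
  fixes s :: nat
  assumes \<eta>: "\<eta> 0 = L" and input: "input m"
  defines "m' \<equiv> run L (Seq (init_reach s) (For 7 (expand_reach s))) \<eta> m"
  shows "\<forall>a. a < 2 * L \<or> 3 * L \<le> a \<longrightarrow> m' a = m a"
    and "cover s \<eta> m \<noteq> {} \<Longrightarrow>
      (\<forall>v\<in>cover s \<eta> m. m' (2 * L + v) \<noteq> 0) \<longleftrightarrow> connected_on E (cover s \<eta> m)"
proof -
  define S where "S = cover s \<eta> m"
  define r where "r = (LEAST v. v \<in> S)"
  let ?R = "induced_arcs E S"
  have SL: "v < L" if "v \<in> S" for v using that L_bounds cover_bound[of v] by (force simp: S_def)
  define m0 where "m0 = run L (init_reach s) \<eta> m"
  note m0 = run_init_reach[where s = s and \<eta> = \<eta> and m = m, OF \<eta> input, folded m0_def S_def]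
  let ?P = "\<lambda>i m'. (\<forall>a. a < 2 * L \<or> 3 * L \<le> a \<longrightarrow> m' a = m a) \<and>
     (\<forall>v<L. m' (2 * L + v) \<noteq> 0 \<longrightarrow> (r, v) \<in> ?R\<^sup>*) \<and>
     (\<forall>v\<in>S. \<forall>j\<le>i. r \<in> S \<longrightarrow> (r, v) \<in> ?R ^^ j \<longrightarrow> m' (2 * L + v) \<noteq> 0)"
  \<comment> \<open>If the cover is empty then the least element \<open>r\<close> is unspecified,
    hence the guard \<open>r \<in> S\<close>.\<close>
  have r: "v \<in> S \<and> (\<forall>u<v. u \<notin> S) \<longleftrightarrow> r \<in> S \<and> v = r" for v
    unfolding r_def by (metis LeastI not_less_Least Least_equality not_le)
  have "?P L m'"
    unfolding m'_def run.simps(2) m0_def[symmetric]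
  proof (rule run_For_invariant[where P = ?P])
    show "?P 0 m0" using m0 SL unfolding r by auto
    fix i m' assume P: "?P i m'"
    have inp: "input m'" using P by (intro input_cong[OF input]) auto
    have S: "cover s (\<eta>(7 := i)) m' = S" using P L_bounds by (auto simp: S_def intro!: cover_cong)
    \<comment> \<open>The closed set \<open>C\<close> is the set of all vertices reachable from the
      root.\<close>
    have C1: "\<forall>v<L. m' (2 * L + v) \<noteq> 0 \<longrightarrow> v \<in> {v. (r, v) \<in> ?R\<^sup>*}" using P by simp
    have C2: "\<forall>u \<in> {v. (r, v) \<in> ?R\<^sup>*} \<inter> cover s (\<eta>(7 := i)) m'.
        \<forall>v \<in> cover s (\<eta>(7 := i)) m'. E u v \<longrightarrow> v \<in> {v. (r, v) \<in> ?R\<^sup>*}"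
      unfolding S by (auto simp: induced_arcs_def intro: rtrancl_into_rtrancl)
    have "(\<eta>(7 := i)) 0 = L" using \<eta> by simp
    note ex = run_expand_reach[where s = s and \<eta> = "\<eta>(7 := i)" and m = m', OF this inp C1 C2, unfolded S]
    show "?P (Suc i) (run L (expand_reach s) (\<eta>(7 := i)) m')"
    proof (intro conjI ballI allI impI)
      fix v j assume v: "v \<in> S" and j: "j \<le> Suc i" and "r \<in> S" and rel: "(r, v) \<in> ?R ^^ j"
      show "run L (expand_reach s) (\<eta>(7 := i)) m' (2 * L + v) \<noteq> 0"
      proof (cases "j \<le> i")
        case True
        have "m' (2 * L + v) \<noteq> 0"
          using P v True rel \<open>r \<in> S\<close> by blast
        then show ?thesis using ex(2) SL[OF v] by blast
      next
        case False
        then have "j = Suc i" using j by simp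
        then obtain u where "(r, u) \<in> ?R ^^ i" "(u, v) \<in> ?R" using rel by auto
        then have "u \<in> S" "E u v" "m' (2 * L + u) \<noteq> 0"
          using P \<open>r \<in> S\<close> by (auto simp: induced_arcs_def)
        then show ?thesis using ex(3) v SL by blast
      qed
    qed (use P ex in auto)
  qed
  then show "\<forall>a. a < 2 * L \<or> 3 * L \<le> a \<longrightarrow> m' a = m a" by blast
  assume "cover s \<eta> m \<noteq> {}"
  then have rS: "r \<in> S" unfolding r_def S_def by (auto intro: LeastI)
  have sub: "?R \<subseteq> {..<n} \<times> {..<n}" using cover_bound by (auto simp: induced_arcs_def S_def)
  have "finite ?R" using sub by (rule finite_subset) simp
  moreover have "card ?R \<le> card ({..<n} \<times> {..<n})" using sub by (intro card_mono) simp_all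
  ultimately have "?R\<^sup>* = (\<Union>j\<in>{j. j \<le> card ?R}. ?R ^^ j)" "card ?R \<le> L"
    using L_bounds(2) by (auto simp: rtrancl_finite_eq_relpow card_cartesian_product)
  then have "\<exists>j\<le>L. (r, v) \<in> ?R ^^ j" if "(r, v) \<in> ?R\<^sup>*" for v
    using that by (auto intro: le_trans)
  then have "m' (2 * L + v) \<noteq> 0 \<longleftrightarrow> (r, v) \<in> ?R\<^sup>*" if "v \<in> S" for v
    using \<open>?P L m'\<close> that rS SL by blast
  moreover have "(\<forall>v\<in>S. (r, v) \<in> ?R\<^sup>*) \<longleftrightarrow> connected_on E S"
    using connected_onI[OF symp_E rS] rS by (auto simp: connected_on_def)
  ultimately show "(\<forall>v\<in>cover s \<eta> m. m' (2 * L + v) \<noteq> 0) \<longleftrightarrow> connected_on E (cover s \<eta> m)"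
    unfolding S_def by blast
qed

lemma holds_cover_test:
  assumes \<eta>: "\<eta> 0 = L" and input: "input m"
  shows "holds L (cover_test s) \<eta> m \<longleftrightarrow> cover s \<eta> m \<noteq> {} \<and>
    (\<forall>v\<in>cover s \<eta> m. m (2 * L + v) \<noteq> 0) \<and>
    (\<forall>u v. E u v \<longrightarrow> u \<in> cover s \<eta> m \<or> v \<in> cover s \<eta> m) \<and> card (cover s \<eta> m) \<le> m (3 * L)"
proof -
  let ?S = "cover s \<eta> m"
  have SL: "v < L" if "v \<in> ?S" for v using cover_bound[OF that] L_bounds by simp
  have EL: "u < L" "v < L" if "E u v" for u v using E_bounds[OF that] L_bounds by auto
  have "eval L (Sum 5 (Cond (in_cover s 5) (Num 1) (Num 0))) \<eta> m =
      (\<Sum>v<L. eval L (Cond (in_cover s 5) (Num 1) (Num 0)) (\<eta>(5 := v)) m)"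
    by (rule eval.simps(7))
  also have "\<dots> = (\<Sum>v<L. of_bool (v \<in> ?S))"
    using holds_in_cover[OF input, of _ s 5] \<eta>
    by (intro sum.cong) (auto simp: holds_def)
  also have "\<dots> = card ({..<L} \<inter> {v. v \<in> ?S})" by simp
  also have "{..<L} \<inter> {v. v \<in> ?S} = ?S" using SL by auto
  finally have "eval L (Sum 5 (Cond (in_cover s 5) (Num 1) (Num 0))) \<eta> m = card ?S" .
  moreover have "holds L (Exists 5 (in_cover s 5)) \<eta> m \<longleftrightarrow> ?S \<noteq> {}"
    using SL \<eta> by (auto simp: holds_in_cover[OF input])
  moreover have "holds L (Forall 5 (Or (Neg (in_cover s 5)) (Fetch (reach_entry 5)))) \<eta> m \<longleftrightarrow>
      (\<forall>v\<in>?S. m (2 * L + v) \<noteq> 0)"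
  proof -
    have "(\<forall>v<L. v \<notin> ?S \<or> m (2 * L + v) \<noteq> 0) \<longleftrightarrow> (\<forall>v\<in>?S. m (2 * L + v) \<noteq> 0)"
      using SL by blast
    then show ?thesis using \<eta> by (simp add: holds_in_cover[OF input])
  qed
  moreover have "holds L (Forall 5 (Forall 6 (Or (Neg (edge 5 6)) (Or (in_cover s 5) (in_cover s 6))))) \<eta> m
      \<longleftrightarrow> (\<forall>u v. E u v \<longrightarrow> u \<in> ?S \<or> v \<in> ?S)"
  proof -
    have "(\<forall>u<L. \<forall>v<L. \<not> E u v \<or> u \<in> ?S \<or> v \<in> ?S) \<longleftrightarrow> (\<forall>u v. E u v \<longrightarrow> u \<in> ?S \<or> v \<in> ?S)"
      using EL by blast
    then show ?thesis using \<eta> by (simp add: holds_in_cover[OF input] holds_edge[OF input])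
  qed
  moreover have "eval L (Fetch bound_cell) \<eta> m = m (3 * L)" using \<eta> by simp
  ultimately show ?thesis
    unfolding cover_test_def holds_simps(2,3,5) by (simp only: not_less)
qed

text \<open>The verdict on a tuple, stated without the memory so that
  \<open>run_nested_loops\<close> can collect it. The sign of \<open>k\<close> is left to
  \<open>cvc_answer\<close>.\<close>

definition good :: "nat \<Rightarrow> (nat \<Rightarrow> nat) \<Rightarrow> bool" where
  "good s \<eta> \<longleftrightarrow> (\<exists>I. greedy_set E s (\<lambda>i. \<eta> (10 + i)) (\<lambda>i. \<eta> (10 + s + i)) {..<n} I \<and>
     (let S = {v. v < n \<and> (v \<notin> I \<or> (\<exists>i<2*s. v = \<eta> (10 + 2 * s + i)))}
      in connected_vertex_cover G S \<and> card S \<le> nat \<bar>k\<bar>))"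

lemma run_test_witness:
  fixes s :: nat
  assumes \<eta>: "\<eta> 0 = L" and ok: "input m \<and> m (3 * L) = nat \<bar>k\<bar>"
  defines "m' \<equiv> run L (test_witness s) \<eta> m"
  shows "(input m' \<and> m' (3 * L) = nat \<bar>k\<bar>) \<and>
    (m' (3 * L + 1) \<noteq> 0 \<longleftrightarrow> m (3 * L + 1) \<noteq> 0 \<or> good s \<eta>)"
proof -
  define m1 where "m1 = run L (compute_indep s) \<eta> m"
  define m2 where "m2 = run L (Seq (init_reach s) (For 7 (expand_reach s))) \<eta> m1"
  define x where "x = eval L (Or (Fetch found_cell) (cover_test s)) \<eta> m2"
  have m': "m' = m2(3 * L + 1 := x)"
    using \<eta> by (simp add: m'_def m2_def m1_def x_def test_witness_def)
  note 1 = run_compute_indep[where s = s and \<eta> = \<eta> and m = m, OF \<eta> conjunct1[OF ok], folded m1_def]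
  have in1: "input m1" using 1(1) by (intro input_cong[OF conjunct1[OF ok]]) auto
  note 2 = run_reach[where s = s and \<eta> = \<eta> and m = m1, OF \<eta> in1, folded m2_def]
  have in2: "input m2" using 2(1) by (intro input_cong[OF in1]) auto
  have S2: "cover s \<eta> m2 = cover s \<eta> m1" using 2(1) L_bounds by (intro cover_cong) auto
  have bound: "m2 (3 * L) = nat \<bar>k\<bar>" "m2 (3 * L + 1) = m (3 * L + 1)"
    using 1(1) 2(1) ok by auto
  let ?I = "{v. v < n \<and> m1 (L + v) \<noteq> 0}"
  have S: "cover s \<eta> m1 = {v. v < n \<and> (v \<notin> ?I \<or> (\<exists>i<2*s. v = \<eta> (10 + 2 * s + i)))}" (is "?S = _")
    by (auto simp: cover_def)
  \<comment> \<open>By uniqueness the quantified \<open>I\<close> in \<open>good\<close> is the set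
    that \<open>compute_indep\<close> leaves in memory.\<close>
  have "good s \<eta> \<longleftrightarrow> connected_vertex_cover G ?S \<and> card ?S \<le> nat \<bar>k\<bar>"
    unfolding good_def S Let_def using 1(2) greedy_set_unique[OF 1(2)] by blast
  also have "\<dots> \<longleftrightarrow> ?S \<noteq> {} \<and> connected_on E ?S \<and> (\<forall>u v. E u v \<longrightarrow> u \<in> ?S \<or> v \<in> ?S) \<and> card ?S \<le> nat \<bar>k\<bar>"
  proof -
    have "?S \<subseteq> pverts G" using n cover_bound by auto
    moreover have "(\<lambda>u v. (u, v) \<in> parcs G) = E" by (simp add: E_def fun_eq_iff)
    moreover have "(\<forall>(u, v)\<in>parcs G. u \<in> ?S \<or> v \<in> ?S) \<longleftrightarrow> (\<forall>u v. E u v \<longrightarrow> u \<in> ?S \<or> v \<in> ?S)"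
      by (auto simp: E_def)
    ultimately show ?thesis
      unfolding connected_vertex_cover_iff[OF G] by (auto simp: connected_on_def)
  qed
  also have "\<dots> \<longleftrightarrow> holds L (cover_test s) \<eta> m2"
    unfolding holds_cover_test[where \<eta> = \<eta> and m = m2, OF \<eta> in2] S2 bound(1) using 2(2) by blast
  finally have "x \<noteq> 0 \<longleftrightarrow> m (3 * L + 1) \<noteq> 0 \<or> good s \<eta>"
    using holds_simps(4,9) \<eta> bound(2) unfolding x_def holds_def[symmetric] by simp
  moreover have "input m'" unfolding m' using L_bounds by (intro input_cong[OF in2]) auto
  ultimately show ?thesis using bound(1) by (simp add: m')
qed

section \<open>Completeness of the search and correctness of the program\<close>

lemma good_if_connected_vertex_cover:
  assumes free: "induced_free (copies s P2) G" and "s \<ge> 1"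
    and S: "connected_vertex_cover G S" "card S \<le> nat \<bar>k\<bar>"
  shows "\<exists>f. (\<forall>i<4*s. f i < L) \<and> good s (\<lambda>x. if 10 \<le> x \<and> x < 10 + 4 * s then f (x - 10) else \<eta> x)"
proof -
  have E: "(\<lambda>u v. (u, v) \<in> parcs G) = E" by (simp add: E_def fun_eq_iff)
  obtain w j t I where wj: "\<forall>i<s. w i < n \<and> j i < n" and t: "\<forall>i<2*s. t i < n"
    and I: "greedy_set E s w j {..<n} I"
    and cvc: "connected_vertex_cover G {v. v < n \<and> (v \<notin> I \<or> (\<exists>i<2*s. v = t i))}"
      "card {v. v < n \<and> (v \<notin> I \<or> (\<exists>i<2*s. v = t i))} \<le> card S"
    using connected_vertex_cover_code[OF G n free \<open>s \<ge> 1\<close> S(1)] unfolding E by (elim exE conjE)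
  \<comment> \<open>The positions match the offsets 10, \<open>10 + s\<close> and
    \<open>10 + 2 * s\<close> at which \<open>w\<close>, \<open>j\<close> and \<open>t\<close> are
    looked up.\<close>
  define f where "f i = (if i < s then w i else if i < 2 * s then j (i - s) else t (i - 2 * s))" for i
  define \<eta>' where "\<eta>' = (\<lambda>x. if 10 \<le> x \<and> x < 10 + 4 * s then f (x - 10) else \<eta> x)"
  have "f i < L" if "i < 4 * s" for i
  proof -
    have "f i < n"
      using wj t that unfolding f_def by (auto split: if_splits)
    then show ?thesis using L_bounds by simp
  qed
  moreover have "good s \<eta>'"
  proof -
    have e: "\<eta>' (10 + i) = w i" "\<eta>' (10 + s + i) = j i" if "i < s" for i
      using that by (auto simp: \<eta>'_def f_def)
    have "\<eta>' (10 + 2 * s + i) = t i" if "i < 2 * s" for i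
      using that by (auto simp: \<eta>'_def f_def)
    then have S': "{v. v < n \<and> (v \<notin> I \<or> (\<exists>i<2*s. v = \<eta>' (10 + 2 * s + i)))} =
        {v. v < n \<and> (v \<notin> I \<or> (\<exists>i<2*s. v = t i))}" by auto
    have "greedy_set E s (\<lambda>i. \<eta>' (10 + i)) (\<lambda>i. \<eta>' (10 + s + i)) {..<n} I"
    proof -
      have "(\<exists>i<s. v = \<eta>' (10 + s + i)) \<longleftrightarrow> (\<exists>i<s. v = j i)" for v using e(2) by metis
      moreover have "(\<forall>i<s. v < \<eta>' (10 + s + i) \<longrightarrow>
            v \<noteq> \<eta>' (10 + i) \<and> \<not> E v (\<eta>' (10 + i)) \<and> \<not> E v (\<eta>' (10 + s + i))) \<longleftrightarrow>
          (\<forall>i<s. v < j i \<longrightarrow> v \<noteq> w i \<and> \<not> E v (w i) \<and> \<not> E v (j i))" for v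
        using e by simp
      ultimately have "greedy_set E s (\<lambda>i. \<eta>' (10 + i)) (\<lambda>i. \<eta>' (10 + s + i)) {..<n} I \<longleftrightarrow>
          greedy_set E s w j {..<n} I"
        unfolding greedy_set_def by (simp only:)
      then show ?thesis using I by simp
    qed
    then show ?thesis unfolding good_def Let_def using cvc S(2) S' by (intro exI[of _ I]) simp
  qed
  ultimately show ?thesis unfolding \<eta>'_def by blast
qed

lemma cvc_program_correct:
  assumes "induced_free (copies s P2) G" "s \<ge> 1"
  shows "eval L cvc_answer (\<lambda>_. L) (run L (cvc_program s) (\<lambda>_. L) (mem (init (cvc_encoding (G, k))))) \<noteq> 0
    \<longleftrightarrow> cvc (G, k)"
proof -
  define m where "m = mem (init (cvc_encoding (G, k)))"
  define m1 where "m1 = run L read_bound (\<lambda>_. L) m"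
  define m2 where "m2 = run L (nested_loops (4 * s) (test_witness s)) (\<lambda>_. L) m1"
  have inm: "input m" unfolding m_def by (rule input_init)
  have zero: "m a = 0" if "a \<ge> L" for a using that by (simp add: m_def init_def L_def)
  have m1: "\<forall>a. a \<noteq> 3 * L \<longrightarrow> m1 a = m a" "m1 (3 * L) = nat \<bar>k\<bar>"
    using run_read_bound[of "\<lambda>_. L" m] inm zero by (auto simp: m1_def)
  have in1: "input m1" using m1(1) L_bounds by (intro input_cong[OF inm]) auto
  let ?G = "\<exists>f. (\<forall>i<4*s. f i < L) \<and> good s (\<lambda>x. if 10 \<le> x \<and> x < 10 + 4 * s then f (x - 10) else L)"
  have "(input m2 \<and> m2 (3 * L) = nat \<bar>k\<bar>) \<and> (m2 (3 * L + 1) \<noteq> 0 \<longleftrightarrow> m1 (3 * L + 1) \<noteq> 0 \<or> ?G)"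
    unfolding m2_def
    by (rule run_nested_loops[where ok = "\<lambda>m. input m \<and> m (3 * L) = nat \<bar>k\<bar>" and flag = "\<lambda>m. m (3 * L + 1) \<noteq> 0"
          and good = "good s" and c = "test_witness s" and \<eta> = "\<lambda>_. L", OF run_test_witness])
       (use in1 m1 in auto)
  moreover have "m1 (3 * L + 1) = 0" using m1(1) zero by simp
  ultimately have m2: "input m2" "m2 (3 * L + 1) \<noteq> 0 \<longleftrightarrow> ?G" by auto
  have "?G \<longleftrightarrow> (\<exists>S. connected_vertex_cover G S \<and> card S \<le> nat \<bar>k\<bar>)"
  proof
    \<comment> \<open>An accepted tuple exhibits a cover by the definition of \<open>good\<close>;
      the converse carries the combinatorics.\<close>
    show "?G \<Longrightarrow> \<exists>S. connected_vertex_cover G S \<and> card S \<le> nat \<bar>k\<bar>"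
      unfolding good_def Let_def by blast
    show "\<exists>S. connected_vertex_cover G S \<and> card S \<le> nat \<bar>k\<bar> \<Longrightarrow> ?G"
      using good_if_connected_vertex_cover[OF assms, of _ "\<lambda>_. L"] by blast
  qed
  moreover have "m2 (n + 1 + n * n) = of_bool (k < 0)" using m2(1) by (simp add: input_def)
  moreover have "eval L cvc_answer (\<lambda>_. L) m2 \<noteq> 0 \<longleftrightarrow> m2 (n + 1 + n * n) = 0 \<and> m2 (3 * L + 1) \<noteq> 0"
    unfolding holds_def[symmetric] by (simp add: cvc_answer_def eval_sign_address[OF m2(1)])
  ultimately have "eval L cvc_answer (\<lambda>_. L) m2 \<noteq> 0 \<longleftrightarrow>
      k \<ge> 0 \<and> (\<exists>S. connected_vertex_cover G S \<and> card S \<le> nat \<bar>k\<bar>)"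
    using m2(2) by auto
  also have "\<dots> \<longleftrightarrow> cvc (G, k)"
    by (auto simp: cvc_def)
  finally show ?thesis by (simp add: cvc_program_def m_def m1_def m2_def)
qed

end

theorem theorem10:
  fixes s :: nat
  assumes "s \<ge> 1"
  shows "solvable_in_poly_time
           {(G, k) \<in> cvc_instances. induced_free (copies s P2) G} cvc_encoding cvc"
proof (rule solvable_in_poly_time_if_run[where e = cvc_answer and c = "cvc_program s"])
  fix i assume "i \<in> {(G, k) \<in> cvc_instances. induced_free (copies s P2) G}"
  then obtain G k n where i: "i = (G, k)" "pair_graph G" "pverts G = {..<n}"
    "induced_free (copies s P2) G"
    by (auto simp: cvc_instances_def)
  interpret cvc_input G k n using i(2,3) by (rule cvc_input.intro)
  show "let L = length (cvc_encoding i) in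
      eval L cvc_answer (\<lambda>_. L) (run L (cvc_program s) (\<lambda>_. L) (mem (init (cvc_encoding i)))) \<noteq> 0
        \<longleftrightarrow> cvc i"
    using cvc_program_correct[OF i(4) assms] unfolding i(1) L_def Let_def .
qed

end
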